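(* Let $X$ be an $L_1$-predual space. Let $Y$ be a finite co-dimensional closed linear subspace of $X$ and let $J$ be an $M$-ideal in $X$ such that $Y\subseteq J$. If $Y$ is strongly proximinal in $J$, then the triplet $(X,Y,\mathcal K(X))$ has property-$(P_1)$.
   Context: All Banach spaces are real and subspaces are closed and linear. A Banach space $X$ is an $L_1$-predual space if $X^*$ is isometric to $L_1(\mu)$ for some positive measure $\mu$. A subspace $J$ of $X$ is an $M$-ideal in $X$ if there is a linear projection $P:X^*\to X^*$ whose range is the annihilator of $J$ in $X^*$ and such that $\|x^*\|=\|Px^*\|+\|x^*-Px^*\|$ for each $x^*\in X^*$. For a Banach space $E$, $B_E$ is its closed unit ball and $\mathcal K(E)$ is the class of non-empty compact subsets of $E$. For $v\in E$ and a non-empty bounded set $F\subseteq E$, $r(v,F)=\sup_{z\in F}\|v-z\|$. For a non-empty closed convex $V\subseteq E$: $\mathrm{rad}_V(F)=\inf_{v\in V}r(v,F)$, $\mathrm{cent}_V(F)=\{v\in V: r(v,F)=\mathrm{rad}_V(F)\}$, and for $\delta>0$, $\mathrm{cent}_V(F,\delta)=\{v\in V: r(v,F)\le \mathrm{rad}_V(F)+\delta\}$. For a family $\mathscr F$ of non-empty closed bounded subsets of $E$, the triplet $(E,V,\mathscr F)$ has property-$(P_1)$ if $\mathrm{cent}_V(F)\neq\emptyset$ for every $F\in\mathscr F$, and for every $\varepsilon>0$ and $F\in\mathscr F$ there is $\delta>0$ with $\mathrm{cent}_V(F,\delta)\subseteq\mathrm{cent}_V(F)+\varepsilon B_E$.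 $V$ is strongly proximinal in $E$ if $(E,V,\mathscr F)$ has property-$(P_1)$ for $\mathscr F$ the class of all singleton subsets of $E$. *)

theory Defs
  imports "HOL-Analysis.Analysis"
begin

text \<open>Elements of \<open>L\<^sub>1(M)\<close> are classes of integrable functions modulo equality almost everywhere.\<close>

definition L1_class :: "'m measure \<Rightarrow> ('m \<Rightarrow> real) \<Rightarrow> ('m \<Rightarrow> real) set" where
  "L1_class M f = {g. integrable M g \<and> (AE x in M. g x = f x)}"

definition L1_space :: "'m measure \<Rightarrow> ('m \<Rightarrow> real) set set" where
  "L1_space M = {L1_class M f | f. integrable M f}"

text \<open>A linear isometry of a normed space onto \<open>L\<^sub>1(M)\<close>; the vector space operations and the norm
  of \<open>L\<^sub>1(M)\<close> are evaluated on representatives.\<close>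

definition isometry_onto_L1 ::
    "'m measure \<Rightarrow> ('b::real_normed_vector \<Rightarrow> ('m \<Rightarrow> real) set) \<Rightarrow> bool" where
  "isometry_onto_L1 M T \<longleftrightarrow>
     bij_betw T UNIV (L1_space M) \<and>
     (\<forall>u v. \<forall>f\<in>T u. \<forall>g\<in>T v. (\<lambda>x. f x + g x) \<in> T (u + v)) \<and>
     (\<forall>c u. \<forall>f\<in>T u. (\<lambda>x. c * f x) \<in> T (c *\<^sub>R u)) \<and>
     (\<forall>u. \<forall>f\<in>T u. (\<integral>x. \<bar>f x\<bar> \<partial>M) = norm u)"

text \<open>The dual of the Banach space is isometric to \<open>L\<^sub>1(M)\<close>. The measure is a parameter because
  HOL has no existential quantifier over its underlying type: a theorem that assumes
  \<open>L1_predual_of TYPE('a) M\<close> for arbitrary \<open>M :: 'm measure\<close> covers every \<open>L\<^sub>1\<close>-predual space.\<close>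

definition L1_predual_of :: "'a::banach itself \<Rightarrow> 'm measure \<Rightarrow> bool" where
  "L1_predual_of _ M \<longleftrightarrow> (\<exists>T :: ('a \<Rightarrow>\<^sub>L real) \<Rightarrow> ('m \<Rightarrow> real) set. isometry_onto_L1 M T)"

definition annihilator :: "'a::real_normed_vector set \<Rightarrow> ('a \<Rightarrow>\<^sub>L real) set" where
  "annihilator J = {\<phi>. \<forall>x\<in>J. blinfun_apply \<phi> x = 0}"

definition M_ideal :: "'a::real_normed_vector set \<Rightarrow> bool" where
  "M_ideal J \<longleftrightarrow> subspace J \<and> closed J \<and>
     (\<exists>P :: ('a \<Rightarrow>\<^sub>L real) \<Rightarrow> ('a \<Rightarrow>\<^sub>L real).
        linear P \<and> P \<circ> P = P \<and> range P = annihilator J \<and>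
        (\<forall>\<phi>. norm \<phi> = norm (P \<phi>) + norm (\<phi> - P \<phi>)))"

text \<open>The quotient by \<open>Y\<close> is finite-dimensional, i.e. spanned by the cosets of the elements
  of a finite set \<open>B\<close>.\<close>

definition finite_codim :: "'a::real_vector set \<Rightarrow> bool" where
  "finite_codim Y \<longleftrightarrow> (\<exists>B. finite B \<and> (\<forall>x. \<exists>b\<in>span B. x - b \<in> Y))"

definition far_radius :: "'a::real_normed_vector \<Rightarrow> 'a set \<Rightarrow> real" where
  "far_radius v F = (SUP z\<in>F. norm (v - z))"

definition rad :: "'a::real_normed_vector set \<Rightarrow> 'a set \<Rightarrow> real" where
  "rad V F = (INF v\<in>V. far_radius v F)"

definition cent :: "'a::real_normed_vector set \<Rightarrow> 'a set \<Rightarrow> 'a set" where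
  "cent V F = {v\<in>V. far_radius v F = rad V F}"

definition approx_cent :: "'a::real_normed_vector set \<Rightarrow> 'a set \<Rightarrow> real \<Rightarrow> 'a set" where
  "approx_cent V F \<delta> = {v\<in>V. far_radius v F \<le> rad V F + \<delta>}"

text \<open>In \<open>property_P1 E V \<F>\<close> the space \<open>E\<close> is a closed subspace of the type and carries the
  inherited norm, so that its unit ball is \<open>cball 0 1 \<inter> E\<close>; \<open>V \<subseteq> E\<close> is non-empty, closed and
  convex, and the members of \<open>\<F>\<close> are non-empty closed bounded subsets of \<open>E\<close>.\<close>

definition property_P1 ::
    "'a::real_normed_vector set \<Rightarrow> 'a set \<Rightarrow> 'a set set \<Rightarrow> bool" where
  "property_P1 E V \<F> \<longleftrightarrow>
     (\<forall>F\<in>\<F>. cent V F \<noteq> {}) \<and>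
     (\<forall>\<epsilon>>0. \<forall>F\<in>\<F>. \<exists>\<delta>>0.
        approx_cent V F \<delta> \<subseteq> {c + \<epsilon> *\<^sub>R b | c b. c \<in> cent V F \<and> b \<in> cball 0 1 \<inter> E})"

definition strongly_proximinal :: "'a::real_normed_vector set \<Rightarrow> 'a set \<Rightarrow> bool" where
  "strongly_proximinal E V \<longleftrightarrow> property_P1 E V {{x} | x. x \<in> E}"

definition nonempty_compacts :: "'a::real_normed_vector set \<Rightarrow> 'a set set" where
  "nonempty_compacts E = {F. F \<noteq> {} \<and> compact F \<and> F \<subseteq> E}"

end

theory Submission
  imports Defs "HOL-Library.Function_Algebras"
begin

text \<open>
  Let \<open>N\<close> be the annihilator of \<open>Y\<close> in \<open>X\<^sup>* = L\<^sub>1(\<mu>)\<close>, and call \<open>h\<close> a part of \<open>s\<close> if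
  \<open>\<parallel>s\<parallel> = \<parallel>h\<parallel> + \<parallel>s - h\<parallel>\<close>; in \<open>L\<^sub>1\<close> this means that \<open>h\<close> lies between \<open>0\<close> and \<open>s\<close> almost everywhere.
  The heart of the proof is a constant \<open>C\<close> such that every \<open>s \<in> X\<^sup>*\<close> has a part \<open>h \<in> N\<close> with
  \<open>\<parallel>s - h\<parallel> \<le> C dist(s, N)\<close>. After splitting off the part of \<open>s\<close> in the \<open>L\<close>-summand \<open>J\<^sup>\<bottom>\<close>, a compactness
  argument in the finite-dimensional space \<open>N\<close> reduces this to the claim that \<open>h / 2\<close> is a part of every
  functional near \<open>h\<close>, for \<open>h \<in> N\<close> disjoint from \<open>J\<^sup>\<bottom>\<close>. If this failed, \<open>h\<close> would have non-zero
  restrictions \<open>h\<^sub>2\<close> of arbitrarily small norm; a point of the unit ball of \<open>J\<close> that almost norms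
  \<open>h - 2 h\<^sub>2\<close> then almost norms \<open>h\<close>, but is far from all points norming \<open>h\<close>, against strong
  proximinality.

  Let \<open>R\<close> be the radius of \<open>F\<close>, let \<open>v \<in> Y\<close> be within \<open>R + \<delta>\<close> of all points of \<open>F\<close>, and let \<open>f\<^sub>i\<close> be
  functionals with sum \<open>s\<close> at points \<open>z\<^sub>i \<in> F\<close>. By Riesz decomposition the part \<open>h\<close> of \<open>s\<close> can be
  distributed over the \<open>f\<^sub>i\<close>. Functionals with sum in \<open>N\<close> satisfy the estimate with \<open>R\<close>, the rest
  satisfies it with \<open>R + \<delta>\<close>, whence
  \<open>\<Sum> f\<^sub>i(z\<^sub>i - v) \<le> R \<Sum> \<parallel>f\<^sub>i\<parallel> + \<delta> C dist(s, N)\<close>. By Hahn-Banach duality this says that, for \<open>\<delta> C \<le> \<epsilon>\<close>,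
  the balls of radius \<open>R + \<eta>\<close> around the points of \<open>F\<close> and the ball of radius \<open>\<epsilon>\<close> around \<open>v\<close> meet
  in \<open>Y\<close>. As \<open>\<delta>\<close> does not depend on \<open>\<eta>\<close>, iteration leads to an exact centre near \<open>v\<close>.
\<close>

section \<open>The Hahn-Banach theorem\<close>

text \<open>Families of vectors become a vector space, so that the Hahn-Banach theorem applies to
  them in \<open>finite_balls_meet_subspace\<close>.\<close>

instantiation "fun" :: (type, real_vector) real_vector
begin

definition scaleR_fun: "c *\<^sub>R f = (\<lambda>x. c *\<^sub>R f x)"

instance
  by standard (simp_all add: scaleR_fun plus_fun_def scaleR_add_right scaleR_add_left)

end

definition sublinear :: "('a::real_vector \<Rightarrow> real) \<Rightarrow> bool" where
  "sublinear p \<longleftrightarrow> (\<forall>x y. p (x + y) \<le> p x + p y) \<and> (\<forall>c>0. \<forall>x. p (c *\<^sub>R x) = c * p x)"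

lemma sublinear_add: "sublinear p \<Longrightarrow> p (x + y) \<le> p x + p y"
  by (simp add: sublinear_def)

lemma sublinear_scale:
  assumes "sublinear p" "0 \<le> c"
  shows "p (c *\<^sub>R x) = c * p x"
proof -
  have "p (2 *\<^sub>R 0) = 2 * p 0"
    using assms(1) unfolding sublinear_def by (metis zero_less_numeral)
  then have "p 0 = 0" by simp
  then show ?thesis
    using assms unfolding sublinear_def by (cases "c = 0") auto
qed

lemma sublinear_zero: "sublinear p \<Longrightarrow> p 0 = 0"
  using sublinear_scale[of p 0 0] by simp

lemma sublinear_minus: "sublinear p \<Longrightarrow> - p (- x) \<le> p x"
  using sublinear_add[of p x "- x"] sublinear_zero[of p] by simp

text \<open>One inequality suffices for homogeneity: the reverse one is the same inequality for
  \<open>1 / c\<close> at \<open>c *\<^sub>R x\<close>.\<close>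

lemma sublinearI:
  assumes "\<And>x y. p (x + y) \<le> p x + p y"
    and "\<And>c x. c > 0 \<Longrightarrow> p (c *\<^sub>R x) \<le> c * p x"
  shows "sublinear p"
  unfolding sublinear_def
proof (intro conjI allI impI)
  fix c :: real and x assume c: "c > 0"
  have "p ((1 / c) *\<^sub>R (c *\<^sub>R x)) \<le> (1 / c) * p (c *\<^sub>R x)"
    using assms(2)[of "1 / c" "c *\<^sub>R x"] c by simp
  then have "c * p x \<le> p (c *\<^sub>R x)"
    using c by (simp add: field_simps)
  then show "p (c *\<^sub>R x) = c * p x" using assms(2)[OF c, of x] by simp
qed (rule assms(1))

text \<open>The minorant is \<open>inf\<^bsub>t \<ge> 0\<^esub> q (x + t y) - t q y\<close>. Applied to a minimal \<open>q\<close>, it shows that \<open>q\<close> is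
  additive; applied with \<open>y = x\<^sub>0\<close>, it yields a functional that agrees with \<open>q\<close> at \<open>x\<^sub>0\<close>.\<close>

lemma sublinear_directional_minorant:
  assumes q: "sublinear q"
  obtains p where "sublinear p" "\<And>x. p x \<le> q x" "\<And>x t. t \<ge> 0 \<Longrightarrow> p x \<le> q (x + t *\<^sub>R y) - t * q y"
proof -
  define S where "S x = {q (x + t *\<^sub>R y) - t * q y | t. t \<ge> 0}" for x
  have bdd: "bdd_below (S x)" for x
  proof (rule bdd_belowI)
    fix s assume "s \<in> S x"
    then obtain t where t: "t \<ge> 0" "s = q (x + t *\<^sub>R y) - t * q y" by (auto simp: S_def)
    have "q (t *\<^sub>R y) \<le> q (x + t *\<^sub>R y) + q (- x)"
      using sublinear_add[OF q, of "x + t *\<^sub>R y" "- x"] by simp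
    then show "- q (- x) \<le> s" using t sublinear_scale[OF q t(1), of y] by simp
  qed
  have ne: "S x \<noteq> {}" for x unfolding S_def by (auto intro: exI[of _ 0])
  have low: "Inf (S x) \<le> q (x + t *\<^sub>R y) - t * q y" if "t \<ge> 0" for x t
    using that by (intro cInf_lower bdd) (auto simp: S_def)
  have sub: "sublinear (\<lambda>x. Inf (S x))"
  proof (rule sublinearI)
    fix x z
    have "Inf (S (x + z)) \<le> a + b" if ab: "a \<in> S x" "b \<in> S z" for a b
    proof -
      obtain s t where st: "s \<ge> 0" "a = q (x + s *\<^sub>R y) - s * q y" "t \<ge> 0" "b = q (z + t *\<^sub>R y) - t * q y"
        using ab by (auto simp: S_def)
      have "Inf (S (x + z)) \<le> q (x + z + (s + t) *\<^sub>R y) - (s + t) * q y"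
        using st by (intro low) simp
      also have "x + z + (s + t) *\<^sub>R y = (x + s *\<^sub>R y) + (z + t *\<^sub>R y)" by (simp add: algebra_simps)
      also have "q \<dots> - (s + t) * q y \<le> a + b"
        using sublinear_add[OF q, of "x + s *\<^sub>R y" "z + t *\<^sub>R y"] st by (simp add: algebra_simps)
      finally show ?thesis .
    qed
    then have "Inf (S (x + z)) - b \<le> Inf (S x)" if "b \<in> S z" for b
      using that by (intro cInf_greatest ne) (force simp: algebra_simps)
    then have "Inf (S (x + z)) - Inf (S x) \<le> Inf (S z)"
      by (intro cInf_greatest ne) (force simp: algebra_simps)
    then show "Inf (S (x + z)) \<le> Inf (S x) + Inf (S z)" by simp
  next
    fix c :: real and x assume c: "c > 0"
    have "Inf (S (c *\<^sub>R x)) / c \<le> a" if "a \<in> S x" for a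
    proof -
      obtain s where s: "s \<ge> 0" "a = q (x + s *\<^sub>R y) - s * q y" using \<open>a \<in> S x\<close> by (auto simp: S_def)
      have "Inf (S (c *\<^sub>R x)) \<le> q (c *\<^sub>R x + (c * s) *\<^sub>R y) - (c * s) * q y"
        using s c by (intro low) simp
      also have "c *\<^sub>R x + (c * s) *\<^sub>R y = c *\<^sub>R (x + s *\<^sub>R y)" by (simp add: algebra_simps)
      also have "q \<dots> = c * q (x + s *\<^sub>R y)" using c by (intro sublinear_scale[OF q]) simp
      finally have "Inf (S (c *\<^sub>R x)) \<le> c * a" by (simp add: s(2) algebra_simps)
      then show ?thesis using c by (simp add: pos_divide_le_eq mult.commute)
    qed
    then have "Inf (S (c *\<^sub>R x)) / c \<le> Inf (S x)" by (intro cInf_greatest ne)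
    then show "Inf (S (c *\<^sub>R x)) \<le> c * Inf (S x)" using c by (simp add: field_simps)
  qed
  have "Inf (S x) \<le> q x" for x using low[of 0 x] by simp
  with sub low show thesis by (intro that[of "\<lambda>x. Inf (S x)"]) auto
qed

lemma minimal_sublinear_linear:
  assumes q: "sublinear q" and min: "\<And>p. sublinear p \<Longrightarrow> (\<And>x. p x \<le> q x) \<Longrightarrow> p = q"
  shows "linear q"
proof -
  have add: "q (x + y) = q x + q y" for x y
  proof -
    obtain p where p: "sublinear p" "\<And>x. p x \<le> q x" "\<And>x t. t \<ge> 0 \<Longrightarrow> p x \<le> q (x + t *\<^sub>R y) - t * q y"
      using sublinear_directional_minorant[OF q, of y] by blast
    have "p = q" by (rule min[OF p(1,2)])
    then have "q x \<le> q (x + y) - q y" using p(3)[of 1 x] by simp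
    then show ?thesis using sublinear_add[OF q, of x y] by simp
  qed
  have neg: "q (- x) = - q x" for x using add[of x "- x"] sublinear_zero[OF q] by simp
  have "q (c *\<^sub>R x) = c * q x" for c x
  proof (cases "c \<ge> 0")
    case False
    then have "q ((- c) *\<^sub>R x) = (- c) * q x" by (intro sublinear_scale[OF q]) simp
    then show ?thesis using neg[of "c *\<^sub>R x"] by simp
  qed (rule sublinear_scale[OF q])
  with add show ?thesis by (intro linearI) auto
qed

text \<open>Zorn's lemma for the sublinear functionals below \<open>p\<close>, ordered downwards.
  The pointwise infimum of a chain is finite because each of them is at least
  \<open>- p (- x)\<close> at \<open>x\<close>.\<close>

lemma minimal_sublinear_exists:
  assumes p: "sublinear p"
  obtains q where "sublinear q" "\<And>x. q x \<le> p x" "\<And>r. sublinear r \<Longrightarrow> (\<And>x. r x \<le> q x) \<Longrightarrow> r = q"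
proof -
  define A where "A = {q. sublinear q \<and> (\<forall>x. q x \<le> p x)}"
  define P where "P f g \<longleftrightarrow> (\<forall>x. g x \<le> (f x :: real))" for f g :: "'a \<Rightarrow> real"
  have low: "- p (- x) \<le> q x" if "q \<in> A" for q x
  proof -
    have "- p (- x) \<le> - q (- x)" using that by (simp add: A_def)
    also have "\<dots> \<le> q x" using that by (intro sublinear_minus) (simp add: A_def)
    finally show ?thesis .
  qed
  have "\<exists>m\<in>A. \<forall>a\<in>A. P m a \<longrightarrow> a = m"
  proof (rule predicate_Zorn)
    show "partial_order_on A (relation_of P A)"
      by (rule partial_order_on_relation_ofI)
        (auto simp: P_def intro: order_trans, meson antisym ext)
    fix C assume "C \<in> Chains (relation_of P A)"
    then have CA: "C \<subseteq> A" and tot: "\<And>f g. f \<in> C \<Longrightarrow> g \<in> C \<Longrightarrow> P f g \<or> P g f"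
      by (auto simp: Chains_def relation_of_def)
    show "\<exists>u\<in>A. \<forall>a\<in>C. P a u"
    proof (cases "C = {}")
      case True then show ?thesis using p by (auto simp: A_def)
    next
      case False
      define u where "u x = (INF f\<in>C. f x)" for x
      have bdd: "bdd_below ((\<lambda>f. f x) ` C)" for x
        using low CA by (intro bdd_belowI2[of _ "- p (- x)"]) auto
      have le: "u x \<le> f x" if "f \<in> C" for f x
        unfolding u_def using that by (intro cINF_lower bdd)
      have "sublinear u"
      proof (rule sublinearI)
        fix x y
        \<comment> \<open>Subadditivity has to be applied to a single functional below both
          \<open>f\<close> and \<open>g\<close>; in a chain the smaller of the two serves.\<close>
        have "u (x + y) \<le> f x + g y" if fg: "f \<in> C" "g \<in> C" for f g
        proof -
          obtain h where h: "h \<in> C" "\<And>x. h x \<le> f x" "\<And>x. h x \<le> g x"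
            using tot[OF fg] fg unfolding P_def by blast
          have "u (x + y) \<le> h (x + y)" by (rule le[OF h(1)])
          also have "\<dots> \<le> h x + h y" using h(1) CA by (intro sublinear_add) (auto simp: A_def)
          finally show ?thesis using h(2)[of x] h(3)[of y] by simp
        qed
        then have "u (x + y) - g y \<le> u x" if "g \<in> C" for g
          unfolding u_def[of x] using that False by (intro cINF_greatest) (auto simp: algebra_simps)
        then have "u (x + y) - u x \<le> u y"
          unfolding u_def[of y] using False by (intro cINF_greatest) (auto simp: algebra_simps)
        then show "u (x + y) \<le> u x + u y" by simp
      next
        fix c :: real and x assume c: "c > 0"
        have "u (c *\<^sub>R x) / c \<le> u x"
          unfolding u_def[of x]
        proof (rule cINF_greatest[OF False])
          fix f assume f: "f \<in> C"
          have "f (c *\<^sub>R x) = c * f x" using f CA c by (intro sublinear_scale) (auto simp: A_def)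
          then show "u (c *\<^sub>R x) / c \<le> f x" using le[OF f, of "c *\<^sub>R x"] c by (simp add: field_simps)
        qed
        then show "u (c *\<^sub>R x) \<le> c * u x" using c by (simp add: field_simps)
      qed
      moreover have "u x \<le> p x" for x
      proof -
        obtain f where f: "f \<in> C" using False by auto
        have "f x \<le> p x" using f CA by (auto simp: A_def)
        with le[OF f, of x] show ?thesis by simp
      qed
      ultimately show ?thesis using le by (auto simp: A_def P_def)
    qed
  qed
  then obtain q where q: "q \<in> A" "\<And>a. a \<in> A \<Longrightarrow> P q a \<Longrightarrow> a = q" by blast
  show thesis
  proof (rule that[of q])
    fix r :: "'a \<Rightarrow> real" assume r: "sublinear r" "\<And>x. r x \<le> q x"
    have "r \<in> A" using r q(1) order_trans[OF r(2)] by (auto simp: A_def)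
    then show "r = q" using r(2) by (intro q(2)) (auto simp: P_def)
  qed (use q in \<open>auto simp: A_def\<close>)
qed

text \<open>The directional minorant \<open>p'\<close> satisfies
  \<open>p' (- x0) \<le> - p x0\<close>, so every linear functional below \<open>p'\<close> is
  forced up to \<open>p x0\<close> at \<open>x0\<close>. A minimal sublinear functional below
  \<open>p'\<close> is such a linear functional.\<close>

theorem hahn_banach_sublinear:
  assumes p: "sublinear p"
  obtains f where "linear f" "\<And>x. f x \<le> p x" "f x0 = p x0"
proof -
  obtain p' where p': "sublinear p'" "\<And>x. p' x \<le> p x"
    "\<And>x t. t \<ge> 0 \<Longrightarrow> p' x \<le> p (x + t *\<^sub>R x0) - t * p x0"
    using sublinear_directional_minorant[OF p, of x0] by blast
  obtain f where f: "sublinear f" "\<And>x. f x \<le> p' x"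
    "\<And>r. sublinear r \<Longrightarrow> (\<And>x. r x \<le> f x) \<Longrightarrow> r = f"
    using minimal_sublinear_exists[OF p'(1)] by blast
  have lin: "linear f" using minimal_sublinear_linear[OF f(1,3)] by blast
  have fp: "f x \<le> p x" for x using f(2) p'(2) order_trans by blast
  have "f (- x0) \<le> - p x0"
    using f(2)[of "- x0"] p'(3)[of 1 "- x0"] sublinear_zero[OF p] by simp
  then have "p x0 \<le> f x0" using lin by (simp add: linear_neg)
  then have "f x0 = p x0" using fp[of x0] by simp
  with lin fp show thesis by (rule that)
qed

section \<open>Duality for balls and subspaces\<close>

lemma blinfun_almost_norming:
  fixes f :: "'a::real_normed_vector \<Rightarrow>\<^sub>L real"
  assumes "\<kappa> > 0"
  obtains u where "norm u \<le> 1" "f u > norm f - \<kappa>"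
proof -
  have "\<exists>u. norm u \<le> 1 \<and> f u > norm f - \<kappa>"
  proof (rule ccontr)
    assume "\<not> ?thesis"
    then have le: "f u \<le> norm f - \<kappa>" if "norm u \<le> 1" for u using that by force
    have "0 \<le> norm f - \<kappa>" using le[of 0] by simp
    have le': "f v \<le> (norm f - \<kappa>) * norm v" for v
    proof (cases "v = 0")
      case False
      have "f ((1 / norm v) *\<^sub>R v) \<le> norm f - \<kappa>" using False by (intro le) simp
      then show ?thesis using False by (simp add: blinfun.scaleR_right field_simps)
    qed simp
    have "norm f \<le> norm f - \<kappa>"
    proof (rule norm_blinfun_bound)
      fix v
      show "norm (f v) \<le> (norm f - \<kappa>) * norm v"
        using le'[of v] le'[of "- v"] by (simp add: blinfun.minus_right abs_le_iff)
    qed fact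
    then show False using assms by simp
  qed
  then show thesis using that by blast
qed

lemma blinfun_of_dominated:
  fixes f :: "'a::real_normed_vector \<Rightarrow> real"
  assumes "linear f" "\<And>x. f x \<le> c * norm x"
  shows "blinfun_apply (Blinfun f) = f"
proof (rule bounded_linear_Blinfun_apply)
  have "\<bar>f x\<bar> \<le> norm x * c" for x
    using assms(2)[of x] assms(2)[of "- x"] linear_neg[OF assms(1), of x]
    by (simp add: abs_le_iff mult.commute)
  then show "bounded_linear f"
    using assms(1) by (intro bounded_linear.intro bounded_linear_axioms.intro) auto
qed

text \<open>The hypothesis says that the distance of \<open>g\<close> from the annihilator is
  \<open>norm g\<close>, and this distance is the norm of the restriction of \<open>g\<close> to
  \<open>J\<close>. If the restriction were smaller, an extension \<open>f\<close> of it with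
  smaller norm would give the element \<open>g - f\<close> of the annihilator at distance
  \<open>norm f < norm g\<close> from \<open>g\<close>.\<close>

lemma hahn_banach_restriction_norm:
  fixes J :: "'a::real_normed_vector set" and g :: "'a \<Rightarrow>\<^sub>L real"
  assumes J: "subspace J" and g: "\<And>j. j \<in> annihilator J \<Longrightarrow> norm g \<le> norm (g - j)"
    and \<eta>: "\<eta> > 0"
  obtains x where "x \<in> J" "norm x \<le> 1" "g x > norm g - \<eta>"
proof -
  have "\<exists>x\<in>J. norm x \<le> 1 \<and> g x > norm g - \<eta>"
  proof (rule ccontr)
    assume "\<not> ?thesis"
    then have le: "g x \<le> norm g - \<eta>" if "norm x \<le> 1" "x \<in> J" for x using that by force
    define c where "c = norm g - \<eta>"
    have c: "0 \<le> c" using le[of 0] subspace_0[OF J] by (simp add: c_def)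
    have gle: "g x \<le> c * norm x" if "x \<in> J" for x
    proof (cases "x = 0")
      case False
      have "g ((1 / norm x) *\<^sub>R x) \<le> c" unfolding c_def using False that
        by (intro le) (auto intro: subspace_scale[OF J])
      then show ?thesis using False by (simp add: blinfun.scaleR_right field_simps)
    qed simp
    \<comment> \<open>The infimum of \<open>S u\<close> is at most \<open>c * norm u\<close> (take
      \<open>x = 0\<close>) and, on \<open>J\<close>, at most \<open>g\<close> (take
      \<open>x = u\<close>). A linear functional below it thus has norm at most \<open>c\<close>,
      and comparison at \<open>x\<close> and \<open>- x\<close> shows that it extends the
      restriction of \<open>g\<close>.\<close>
    define S where "S u = {c * norm (u - x) + g x | x. x \<in> J}" for u
    have ne: "S u \<noteq> {}" for u using subspace_0[OF J] by (auto simp: S_def)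
    have bdd: "bdd_below (S u)" for u
    proof (rule bdd_belowI)
      fix s assume "s \<in> S u"
      then obtain x where x: "x \<in> J" "s = c * norm (u - x) + g x" by (auto simp: S_def)
      have "- g x \<le> c * norm x" using gle[of "- x"] subspace_neg[OF J x(1)] by (simp add: blinfun.minus_right)
      also have "norm x \<le> norm (u - x) + norm u" by (metis norm_triangle_sub norm_minus_commute add.commute)
      then have "c * norm x \<le> c * norm (u - x) + c * norm u" using c by (simp add: mult_left_mono flip: distrib_left)
      finally show "- (c * norm u) \<le> s" using x by simp
    qed
    have low: "Inf (S u) \<le> c * norm (u - x) + g x" if "x \<in> J" for u x
      using that by (intro cInf_lower bdd) (auto simp: S_def)
    have "sublinear (\<lambda>u. Inf (S u))"
    proof (rule sublinearI)
      fix u v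
      have "Inf (S (u + v)) \<le> a + b" if ab: "a \<in> S u" "b \<in> S v" for a b
      proof -
        obtain x y where xy: "x \<in> J" "a = c * norm (u - x) + g x" "y \<in> J" "b = c * norm (v - y) + g y"
          using ab by (auto simp: S_def)
        have "norm (u + v - (x + y)) \<le> norm (u - x) + norm (v - y)"
          by (metis add_diff_add norm_triangle_ineq)
        then have "c * norm (u + v - (x + y)) \<le> c * norm (u - x) + c * norm (v - y)"
          using c by (simp add: mult_left_mono flip: distrib_left)
        then show ?thesis using low[of "x + y" "u + v"] xy subspace_add[OF J xy(1,3)]
          by (simp add: blinfun.add_right)
      qed
      then have "Inf (S (u + v)) - b \<le> Inf (S u)" if "b \<in> S v" for b
        using that by (intro cInf_greatest ne) (force simp: algebra_simps)
      then have "Inf (S (u + v)) - Inf (S u) \<le> Inf (S v)"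
        by (intro cInf_greatest ne) (force simp: algebra_simps)
      then show "Inf (S (u + v)) \<le> Inf (S u) + Inf (S v)" by simp
    next
      fix t :: real and u assume t: "t > 0"
      have "Inf (S (t *\<^sub>R u)) / t \<le> a" if a: "a \<in> S u" for a
      proof -
        obtain x where x: "x \<in> J" "a = c * norm (u - x) + g x" using a by (auto simp: S_def)
        have "Inf (S (t *\<^sub>R u)) \<le> c * norm (t *\<^sub>R u - t *\<^sub>R x) + g (t *\<^sub>R x)"
          using x by (intro low subspace_scale[OF J])
        also have "\<dots> = t * a"
          using t by (simp add: x(2) blinfun.scaleR_right algebra_simps flip: scaleR_right_diff_distrib)
        finally show ?thesis using t by (simp add: pos_divide_le_eq mult.commute)
      qed
      then have "Inf (S (t *\<^sub>R u)) / t \<le> Inf (S u)" by (intro cInf_greatest ne)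
      then show "Inf (S (t *\<^sub>R u)) \<le> t * Inf (S u)" using t by (simp add: field_simps)
    qed
    then obtain f where f: "linear f" "\<And>u. f u \<le> Inf (S u)" by (rule hahn_banach_sublinear[where ?x0.0 = 0]) blast
    have fc: "f u \<le> c * norm u" for u using f(2)[of u] low[OF subspace_0[OF J], of u] by simp
    have fg: "f x = g x" if "x \<in> J" for x
      using f(2)[of x] f(2)[of "- x"] low[OF that, of x] low[OF subspace_neg[OF J that], of "- x"]
        linear_neg[OF f(1), of x] by (simp add: blinfun.minus_right)
    have ap: "blinfun_apply (Blinfun f) = f" by (rule blinfun_of_dominated[OF f(1) fc])
    have "g - Blinfun f \<in> annihilator J" by (simp add: annihilator_def blinfun.diff_left ap fg)
    from g[OF this] have "norm g \<le> norm (Blinfun f)" by simp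
    also have "\<dots> \<le> c"
    proof (rule norm_blinfun_bound[OF c])
      fix x show "norm (Blinfun f x) \<le> c * norm x"
        using fc[of x] fc[of "- x"] linear_neg[OF f(1), of x] by (simp add: ap abs_le_iff)
    qed
    finally show False using \<eta> by (simp add: c_def)
  qed
  then show thesis using that by blast
qed

text \<open>The infimum of the \<open>s\<close> for which the balls of radius \<open>s * r i\<close>
  around the \<open>u i\<close> have a common point in \<open>Y\<close> is sublinear in
  \<open>u\<close>. If the conclusion failed, its value at \<open>x\<close> would be at least
  \<open>t\<close>, and a Hahn-Banach functional attaining it would split into coordinates
  \<open>f i\<close> that contradict \<open>dual\<close>. The margin \<open>t > 1\<close> is there
  because the infimum need not be attained.\<close>

lemma finite_balls_meet_subspace:
  fixes Y :: "'a::real_normed_vector set" and x :: "'i \<Rightarrow> 'a"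
  assumes I: "finite I" and r: "\<And>i. i \<in> I \<Longrightarrow> r i > 0" and Y: "subspace Y"
    and dual: "\<And>f :: 'i \<Rightarrow> 'a \<Rightarrow>\<^sub>L real. (\<Sum>i\<in>I. f i) \<in> annihilator Y \<Longrightarrow>
      (\<Sum>i\<in>I. f i (x i)) \<le> (\<Sum>i\<in>I. r i * norm (f i))"
    and t: "t > 1"
  shows "\<exists>y\<in>Y. \<forall>i\<in>I. norm (x i - y) \<le> t * r i"
proof (rule ccontr)
  assume contra: "\<not> ?thesis"
  define S where "S u = {s. s \<ge> 0 \<and> (\<exists>y\<in>Y. \<forall>i\<in>I. norm (u i - y) \<le> s * r i)}" for u :: "'i \<Rightarrow> 'a"
  have bdd: "bdd_below (S u)" for u by (rule bdd_belowI[of _ 0]) (auto simp: S_def)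
  have ne: "S u \<noteq> {}" for u
  proof -
    have "norm (u i) \<le> (\<Sum>i\<in>I. norm (u i) / r i) * r i" if "i \<in> I" for i
    proof -
      have "norm (u i) / r i \<le> (\<Sum>i\<in>I. norm (u i) / r i)"
        using I that r by (intro member_le_sum) (auto intro: divide_nonneg_pos)
      then show ?thesis using r[OF that] by (simp add: field_simps)
    qed
    moreover have "0 \<le> (\<Sum>i\<in>I. norm (u i) / r i)" using r by (intro sum_nonneg) (auto intro: divide_nonneg_pos)
    ultimately have "(\<Sum>i\<in>I. norm (u i) / r i) \<in> S u"
      using subspace_0[OF Y] by (auto simp: S_def intro!: bexI[of _ 0])
    then show ?thesis by blast
  qed
  have low: "Inf (S u) \<le> s" if "s \<ge> 0" "y \<in> Y" "\<And>i. i \<in> I \<Longrightarrow> norm (u i - y) \<le> s * r i" for u s y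
    using that by (intro cInf_lower bdd) (auto simp: S_def)
  have sub: "sublinear (\<lambda>u. Inf (S u))"
  proof (rule sublinearI)
    fix u v
    have "Inf (S (u + v)) \<le> a + b" if ab: "a \<in> S u" "b \<in> S v" for a b
    proof -
      obtain y z where yz: "a \<ge> 0" "y \<in> Y" "\<And>i. i \<in> I \<Longrightarrow> norm (u i - y) \<le> a * r i"
        "b \<ge> 0" "z \<in> Y" "\<And>i. i \<in> I \<Longrightarrow> norm (v i - z) \<le> b * r i"
        using ab by (auto simp: S_def)
      show ?thesis
      proof (rule low[of _ "y + z"])
        fix i assume i: "i \<in> I"
        have "norm ((u + v) i - (y + z)) \<le> norm (u i - y) + norm (v i - z)"
          unfolding plus_fun_def by (metis add_diff_add norm_triangle_ineq)
        then show "norm ((u + v) i - (y + z)) \<le> (a + b) * r i"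
          using yz(3,6)[OF i] by (simp add: distrib_right)
      qed (use yz subspace_add[OF Y] in auto)
    qed
    then have "Inf (S (u + v)) - b \<le> Inf (S u)" if "b \<in> S v" for b
      using that by (intro cInf_greatest ne) (force simp: algebra_simps)
    then have "Inf (S (u + v)) - Inf (S u) \<le> Inf (S v)"
      by (intro cInf_greatest ne) (force simp: algebra_simps)
    then show "Inf (S (u + v)) \<le> Inf (S u) + Inf (S v)" by simp
  next
    fix c :: real and u :: "'i \<Rightarrow> 'a" assume c: "c > 0"
    have "Inf (S (c *\<^sub>R u)) / c \<le> a" if a: "a \<in> S u" for a
    proof -
      obtain y where y: "a \<ge> 0" "y \<in> Y" "\<And>i. i \<in> I \<Longrightarrow> norm (u i - y) \<le> a * r i"
        using a by (auto simp: S_def)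
      have "Inf (S (c *\<^sub>R u)) \<le> c * a"
      proof (rule low[of _ "c *\<^sub>R y"])
        fix i assume i: "i \<in> I"
        show "norm ((c *\<^sub>R u) i - c *\<^sub>R y) \<le> c * a * r i"
          using y(3)[OF i] c by (simp add: scaleR_fun mult.assoc flip: scaleR_right_diff_distrib)
      qed (use y c subspace_scale[OF Y] in auto)
      then show ?thesis using c by (simp add: pos_divide_le_eq mult.commute)
    qed
    then have "Inf (S (c *\<^sub>R u)) / c \<le> Inf (S u)" by (intro cInf_greatest ne)
    then show "Inf (S (c *\<^sub>R u)) \<le> c * Inf (S u)" using c by (simp add: field_simps)
  qed
  \<comment> \<open>Outside \<open>I\<close> the family is replaced by 0, so that it is a finite sum
    of the one-coordinate families \<open>e i v\<close> below.\<close>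
  define x' where "x' i = (if i \<in> I then x i else 0)" for i
  obtain \<Phi> where \<Phi>: "linear \<Phi>" "\<And>u. \<Phi> u \<le> Inf (S u)" "\<Phi> x' = Inf (S x')"
    using hahn_banach_sublinear[OF sub, of x'] by blast
  have "t \<le> Inf (S x')"
  proof (rule cInf_greatest[OF ne])
    fix s assume "s \<in> S x'"
    then obtain y where y: "y \<in> Y" "\<And>i. i \<in> I \<Longrightarrow> norm (x i - y) \<le> s * r i" by (auto simp: S_def x'_def)
    show "t \<le> s"
    proof (rule ccontr)
      assume "\<not> t \<le> s"
      then have "norm (x i - y) \<le> t * r i" if "i \<in> I" for i
        using y(2)[OF that] r[OF that] order_trans[OF _ mult_right_mono[of s t "r i"]] by simp
      then show False using contra y(1) by blast
    qed
  qed
  then have \<Phi>x: "\<Phi> x' > 1" using \<Phi>(3) t by simp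
  define e where "e i v = (\<lambda>k. if k = i then v else 0)" for i :: 'i and v :: 'a
  have lin_e: "linear (\<lambda>v. \<Phi> (e i v))" for i
  proof (rule linearI)
    fix v w :: 'a and c :: real
    have "e i (v + w) = e i v + e i w" by (auto simp: e_def plus_fun_def)
    then show "\<Phi> (e i (v + w)) = \<Phi> (e i v) + \<Phi> (e i w)" by (simp add: linear_add[OF \<Phi>(1)])
    have "e i (c *\<^sub>R v) = c *\<^sub>R e i v" by (auto simp: e_def scaleR_fun)
    then show "\<Phi> (e i (c *\<^sub>R v)) = c *\<^sub>R \<Phi> (e i v)" by (simp add: linear_scale[OF \<Phi>(1)])
  qed
  define f where "f i = Blinfun (\<lambda>v. \<Phi> (e i v))" for i
  have f: "blinfun_apply (f i) v = \<Phi> (e i v)" if "i \<in> I" for i v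
  proof -
    have "\<Phi> (e i v) \<le> (1 / r i) * norm v" for v
      using r[OF that] r by (intro order_trans[OF \<Phi>(2)] low[OF _ subspace_0[OF Y]])
        (auto simp: e_def less_imp_le)
    from blinfun_of_dominated[OF lin_e this] show ?thesis by (simp add: f_def)
  qed
  have sum_f: "(\<Sum>i\<in>I. f i (u i)) = \<Phi> u" if "\<And>i. i \<notin> I \<Longrightarrow> u i = 0" for u
  proof -
    have "u = (\<Sum>i\<in>I. e i (u i))"
    proof
      fix k
      have "(\<Sum>i\<in>I. e i (u i)) k = (\<Sum>i\<in>I. e i (u i) k)"
        using I by (induction I) (auto simp: plus_fun_def zero_fun_def)
      also have "\<dots> = u k" using I that[of k] by (simp add: e_def)
      finally show "u k = (\<Sum>i\<in>I. e i (u i)) k" by simp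
    qed
    then have "\<Phi> u = (\<Sum>i\<in>I. \<Phi> (e i (u i)))" by (metis linear_sum[OF \<Phi>(1)])
    then show ?thesis by (simp add: f)
  qed
  have norms: "(\<Sum>i\<in>I. r i * norm (f i)) \<le> 1"
  proof (rule field_le_epsilon)
    fix \<epsilon> :: real assume \<epsilon>: "\<epsilon> > 0"
    define \<kappa> where "\<kappa> = \<epsilon> / (1 + (\<Sum>i\<in>I. r i))"
    have rs: "(\<Sum>i\<in>I. r i) \<ge> 0" using r by (intro sum_nonneg) (auto intro: less_imp_le)
    have \<kappa>: "\<kappa> > 0" using \<epsilon> rs by (simp add: \<kappa>_def)
    have "\<forall>i. \<exists>u. norm u \<le> 1 \<and> f i u > norm (f i) - \<kappa>"
      using blinfun_almost_norming[OF \<kappa>] by metis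
    then obtain u where u: "\<And>i. norm (u i) \<le> 1" "\<And>i. f i (u i) > norm (f i) - \<kappa>" by metis
    \<comment> \<open>Each \<open>w i\<close> has length at most \<open>r i\<close> and almost
      attains \<open>r i * norm (f i)\<close> under \<open>f i\<close>. As 0 is in all the balls of
      radius \<open>r i\<close>, the functional is at most 1 at \<open>w\<close>.\<close>
    define w where "w i = (if i \<in> I then r i *\<^sub>R u i else 0)" for i
    have "\<Phi> w \<le> 1"
    proof (rule order_trans[OF \<Phi>(2)], rule low[OF _ subspace_0[OF Y]])
      fix i assume "i \<in> I"
      then show "norm (w i - 0) \<le> 1 * r i" using u(1)[of i] r[of i] by (simp add: w_def mult_left_le)
    qed simp
    moreover have "\<Phi> w = (\<Sum>i\<in>I. r i * f i (u i))"
      using sum_f[of w] by (simp add: w_def blinfun.scaleR_right)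
    moreover have "(\<Sum>i\<in>I. r i * norm (f i) - r i * \<kappa>) \<le> (\<Sum>i\<in>I. r i * f i (u i))"
    proof (rule sum_mono)
      fix i assume "i \<in> I"
      then show "r i * norm (f i) - r i * \<kappa> \<le> r i * f i (u i)"
        using mult_left_mono[of "norm (f i) - \<kappa>" "f i (u i)" "r i"] u(2)[of i] r[of i]
        by (simp add: right_diff_distrib)
    qed
    moreover have "(\<Sum>i\<in>I. r i * \<kappa>) \<le> \<epsilon>"
    proof -
      have "(\<Sum>i\<in>I. r i * \<kappa>) = (\<Sum>i\<in>I. r i) * \<kappa>" by (simp add: sum_distrib_right)
      also have "\<dots> \<le> (1 + (\<Sum>i\<in>I. r i)) * \<kappa>" using \<kappa> by (intro mult_right_mono) auto
      also have "\<dots> = \<epsilon>" using rs by (simp add: \<kappa>_def)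
      finally show ?thesis .
    qed
    ultimately show "(\<Sum>i\<in>I. r i * norm (f i)) \<le> 1 + \<epsilon>" by (simp add: sum_subtractf)
  qed
  have "(\<Sum>i\<in>I. f i) \<in> annihilator Y"
    unfolding annihilator_def
  proof (clarify)
    fix y assume y: "y \<in> Y"
    \<comment> \<open>For a constant family with value in \<open>Y\<close> the infimum is 0, since
      the value itself is a common point. Applying this to \<open>y\<close> and \<open>- y\<close>
      gives equality.\<close>
    have le: "(\<Sum>i\<in>I. f i z) \<le> 0" if z: "z \<in> Y" for z
    proof -
      have "(\<Sum>i\<in>I. f i z) = \<Phi> (\<lambda>i. if i \<in> I then z else 0)"
        by (subst sum_f[symmetric]) auto
      also have "\<dots> \<le> 0" by (rule order_trans[OF \<Phi>(2)], rule low[OF _ z]) auto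
      finally show ?thesis .
    qed
    show "(\<Sum>i\<in>I. f i) y = 0"
      using le[OF y] le[OF subspace_neg[OF Y y]]
      by (simp add: blinfun.sum_left blinfun.minus_right sum_negf)
  qed
  from dual[OF this] have "(\<Sum>i\<in>I. f i (x i)) \<le> 1" using norms by simp
  moreover have "(\<Sum>i\<in>I. f i (x i)) = \<Phi> x'"
    by (subst sum_f[symmetric]) (auto simp: x'_def)
  ultimately show False using \<Phi>x by simp
qed

section \<open>Finite codimension\<close>

text \<open>The point \<open>b\<close> has positive distance \<open>d\<close> from the closed
  subspace, and scaling by \<open>t\<close> scales this distance. This bounds the coefficient along
  \<open>b\<close> when one dimension is added.\<close>

lemma coefficient_bound_mod_closed_subspace:
  fixes V :: "'a::real_normed_vector set"
  assumes V: "subspace V" "closed V" and b: "b \<notin> V"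
  obtains d where "d > 0" "\<And>u t. u \<in> V \<Longrightarrow> \<bar>t\<bar> * d \<le> norm (u + t *\<^sub>R b)"
proof -
  obtain d where d: "d > 0" "\<And>v. v \<in> V \<Longrightarrow> d \<le> norm (v - b)"
  proof -
    have "open (- V)" "b \<in> - V" using V b by auto
    then obtain d where "d > 0" "\<And>v. dist v b < d \<Longrightarrow> v \<in> - V" unfolding open_dist by blast
    then show thesis by (intro that[of d]) (force simp: dist_norm)+
  qed
  show thesis
  proof (rule that[OF d(1)])
    fix u and t :: real assume u: "u \<in> V"
    show "\<bar>t\<bar> * d \<le> norm (u + t *\<^sub>R b)"
    proof (cases "t = 0")
      case False
      have "d \<le> norm ((- 1 / t) *\<^sub>R u - b)" by (intro d(2) subspace_scale V u)
      then have "\<bar>t\<bar> * d \<le> norm ((- t) *\<^sub>R ((- 1 / t) *\<^sub>R u - b))"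
        using False by (simp add: mult_left_mono)
      also have "(- t) *\<^sub>R ((- 1 / t) *\<^sub>R u - b) = u + t *\<^sub>R b"
        using False by (simp add: algebra_simps)
      finally show ?thesis .
    qed simp
  qed
qed

definition sum_span :: "'a::real_vector set \<Rightarrow> 'a set \<Rightarrow> 'a set" where
  "sum_span Y B = {x. \<exists>b\<in>span B. x - b \<in> Y}"

lemma subspace_sum_span:
  assumes "subspace Y"
  shows "subspace (sum_span Y B)"
proof (rule subspaceI)
  show "0 \<in> sum_span Y B" using subspace_0[OF assms] by (auto simp: sum_span_def intro: bexI[OF _ span_zero])
next
  fix x y assume "x \<in> sum_span Y B" "y \<in> sum_span Y B"
  then obtain a b where "a \<in> span B" "x - a \<in> Y" "b \<in> span B" "y - b \<in> Y" by (auto simp: sum_span_def)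
  then show "x + y \<in> sum_span Y B"
    using subspace_add[OF assms, of "x - a" "y - b"] span_add[of a B b]
    by (auto simp: sum_span_def algebra_simps intro!: bexI[of _ "a + b"])
next
  fix c x assume "x \<in> sum_span Y B"
  then obtain a where "a \<in> span B" "x - a \<in> Y" by (auto simp: sum_span_def)
  then show "c *\<^sub>R x \<in> sum_span Y B"
    using subspace_scale[OF assms, of "x - a" c] span_scale[of a B c]
    by (auto simp: sum_span_def algebra_simps intro!: bexI[of _ "c *\<^sub>R a"])
qed

lemma sum_span_insert:
  assumes "x \<in> sum_span Y (insert b B)"
  obtains u t where "u \<in> sum_span Y B" "x = u + t *\<^sub>R b"
proof -
  obtain a where a: "a \<in> span (insert b B)" "x - a \<in> Y" using assms by (auto simp: sum_span_def)
  then obtain t where t: "a - t *\<^sub>R b \<in> span B" using span_breakdown_eq by blast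
  have "x - t *\<^sub>R b - (a - t *\<^sub>R b) \<in> Y" using a(2) by simp
  with t have "x - t *\<^sub>R b \<in> sum_span Y B" unfolding sum_span_def by blast
  then show thesis by (intro that[of "x - t *\<^sub>R b" t]) simp_all
qed

text \<open>The unit ball of a finite-dimensional quotient is compact; sequential compactness is stated
  with representatives so that the quotient space need not be constructed.\<close>

lemma finite_quotient_compact:
  fixes Y :: "'a::real_normed_vector set"
  assumes Y: "subspace Y" "closed Y" and B: "finite B"
  shows "closed (sum_span Y B) \<and>
    (\<forall>x :: nat \<Rightarrow> 'a. range x \<subseteq> sum_span Y B \<longrightarrow> bounded (range x) \<longrightarrow>
      (\<exists>r y l. strict_mono r \<and> range y \<subseteq> Y \<and> (\<lambda>n. x (r n) - y n) \<longlonglongrightarrow> l))"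
  using B
proof induction
  case empty
  have "sum_span Y {} = Y" by (auto simp: sum_span_def)
  moreover have "\<exists>r y l. strict_mono r \<and> range y \<subseteq> Y \<and> (\<lambda>n. x (r n) - y n) \<longlonglongrightarrow> l"
    if "range x \<subseteq> Y" for x :: "nat \<Rightarrow> 'a"
    using that by (intro exI[of _ id] exI[of _ x] exI[of _ 0]) (auto simp: strict_mono_def)
  ultimately show ?case using Y by simp
next
  case (insert b B)
  define V where "V = sum_span Y B"
  have V: "subspace V" "closed V" using insert subspace_sum_span[OF Y(1)] by (auto simp: V_def)
  show ?case
  proof (cases "b \<in> V")
    case True
    have "sum_span Y (insert b B) = V"
    proof (rule set_eqI, rule iffI)
      fix x assume "x \<in> sum_span Y (insert b B)"
      then obtain u t where "u \<in> V" "x = u + t *\<^sub>R b" unfolding V_def by (rule sum_span_insert)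
      then show "x \<in> V" using True V(1) by (simp add: subspace_add subspace_scale)
    next
      fix x assume "x \<in> V"
      then show "x \<in> sum_span Y (insert b B)"
        using span_mono[of B "insert b B"] by (auto simp: V_def sum_span_def)
    qed
    then show ?thesis using insert by (simp add: V_def)
  next
    case False
    obtain d where d: "d > 0" "\<And>u t. u \<in> V \<Longrightarrow> \<bar>t\<bar> * d \<le> norm (u + t *\<^sub>R b)"
      using coefficient_bound_mod_closed_subspace[OF V False] by blast
    \<comment> \<open>The coefficients along \<open>b\<close> are bounded, so a subsequence of them
      converges, and the components in \<open>V\<close> stay bounded. Closedness of the larger sum
      and convergence modulo \<open>Y\<close> both reduce to \<open>V\<close> in this way.\<close>
    have split: "\<exists>r u t s. strict_mono r \<and> (\<forall>n. u n \<in> V \<and> x n = u n + t n *\<^sub>R b) \<and> (t \<circ> r) \<longlonglongrightarrow> s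
        \<and> bounded (range u)"
      if x: "range x \<subseteq> sum_span Y (insert b B)" "bounded (range x)" for x :: "nat \<Rightarrow> 'a"
    proof -
      have "\<forall>n. \<exists>u t. u \<in> V \<and> x n = u + t *\<^sub>R b"
      proof
        fix n
        have "x n \<in> sum_span Y (insert b B)" using x(1) by auto
        then show "\<exists>u t. u \<in> V \<and> x n = u + t *\<^sub>R b"
          unfolding V_def by (rule sum_span_insert) blast
      qed
      then obtain u t where ut: "\<And>n. u n \<in> V" "\<And>n. x n = u n + t n *\<^sub>R b" by metis
      obtain M where M: "\<And>n. norm (x n) \<le> M" using x(2) by (auto simp: bounded_iff)
      have t: "\<bar>t n\<bar> \<le> M / d" for n
        using d(2)[OF ut(1)[of n], of "t n"] M[of n] ut(2)[of n] d(1) by (simp add: pos_le_divide_eq)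
      then have "bounded (range t)" by (auto simp: bounded_iff)
      then obtain s r where "strict_mono r" "(t \<circ> r) \<longlonglongrightarrow> s"
        using bounded_imp_convergent_subsequence by blast
      moreover have "norm (u n) \<le> M + M / d * norm b" for n
      proof -
        have "norm (u n) \<le> norm (x n) + \<bar>t n\<bar> * norm b"
          using norm_triangle_ineq4[of "x n" "t n *\<^sub>R b"] ut(2)[of n] by simp
        then show ?thesis using M[of n] mult_right_mono[OF t[of n], of "norm b"] by simp
      qed
      then have "bounded (range u)" by (auto simp: bounded_iff)
      ultimately show ?thesis using ut by blast
    qed
    have "closed (sum_span Y (insert b B))"
      unfolding closed_sequential_limits
    proof (intro allI impI, elim conjE)
      fix x :: "nat \<Rightarrow> 'a" and l assume x: "\<forall>n. x n \<in> sum_span Y (insert b B)" "x \<longlonglongrightarrow> l"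
      have "range x \<subseteq> sum_span Y (insert b B)" using x(1) by auto
      from split[OF this convergent_imp_bounded[OF x(2)]]
      obtain r u t s where all: "strict_mono r \<and> (\<forall>n. u n \<in> V \<and> x n = u n + t n *\<^sub>R b)
        \<and> (t \<circ> r) \<longlonglongrightarrow> s \<and> bounded (range u)" by (elim exE) (rule that)
      have *: "strict_mono r" "\<And>n. u n \<in> V" "\<And>n. x n = u n + t n *\<^sub>R b"
        "(t \<circ> r) \<longlonglongrightarrow> s" "bounded (range u)" using all by simp_all
      have "(\<lambda>n. x (r n) - t (r n) *\<^sub>R b) \<longlonglongrightarrow> l - s *\<^sub>R b"
        using LIMSEQ_subseq_LIMSEQ[OF x(2) *(1)] *(4) by (intro tendsto_intros) (auto simp: o_def)
      moreover have "x (r n) - t (r n) *\<^sub>R b \<in> V" for n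
        using *(2)[of "r n"] *(3)[of "r n"] by simp
      ultimately have "l - s *\<^sub>R b \<in> V" by (rule closed_sequentially[OF V(2), rotated])
      then obtain a where a: "a \<in> span B" "l - s *\<^sub>R b - a \<in> Y" by (auto simp: V_def sum_span_def)
      have "a + s *\<^sub>R b \<in> span (insert b B)"
        using a(1) by (auto simp: span_breakdown_eq intro!: exI[of _ s])
      moreover have "l - (a + s *\<^sub>R b) \<in> Y" using a(2) by (simp add: algebra_simps)
      ultimately show "l \<in> sum_span Y (insert b B)" unfolding sum_span_def by blast
    qed
    moreover have "\<exists>r y l. strict_mono r \<and> range y \<subseteq> Y \<and> (\<lambda>n. x (r n) - y n) \<longlonglongrightarrow> l"
      if x: "range x \<subseteq> sum_span Y (insert b B)" "bounded (range x)" for x :: "nat \<Rightarrow> 'a"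
    proof -
      from split[OF x]
      obtain r u t s where all: "strict_mono r \<and> (\<forall>n. u n \<in> V \<and> x n = u n + t n *\<^sub>R b)
        \<and> (t \<circ> r) \<longlonglongrightarrow> s \<and> bounded (range u)" by (elim exE) (rule that)
      have *: "strict_mono r" "\<And>n. u n \<in> V" "\<And>n. x n = u n + t n *\<^sub>R b"
        "(t \<circ> r) \<longlonglongrightarrow> s" "bounded (range u)" using all by simp_all
      have "range (u \<circ> r) \<subseteq> sum_span Y B" "bounded (range (u \<circ> r))"
        using *(2) bounded_subset[OF *(5), of "range (u \<circ> r)"] by (auto simp: V_def)
      then obtain q y l where q: "strict_mono q" "range y \<subseteq> Y" "(\<lambda>n. (u \<circ> r) (q n) - y n) \<longlonglongrightarrow> l"
        using insert.IH by blast
      have "(\<lambda>n. ((u \<circ> r) (q n) - y n) + (t \<circ> r \<circ> q) n *\<^sub>R b) \<longlonglongrightarrow> l + s *\<^sub>R b"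
        using q(3) LIMSEQ_subseq_LIMSEQ[OF *(4) q(1)] by (intro tendsto_intros)
      then have "(\<lambda>n. x ((r \<circ> q) n) - y n) \<longlonglongrightarrow> l + s *\<^sub>R b"
        by (simp add: *(3) algebra_simps)
      then show ?thesis using q(2) strict_mono_o[OF *(1) q(1)] by blast
    qed
    ultimately show ?thesis by blast
  qed
qed

lemma finite_codim_seq_compact:
  fixes Y :: "'a::real_normed_vector set"
  assumes "subspace Y" "closed Y" "finite_codim Y" "bounded (range (x :: nat \<Rightarrow> 'a))"
  obtains r y l where "strict_mono r" "range y \<subseteq> Y" "(\<lambda>n. x (r n) - y n) \<longlonglongrightarrow> l"
proof -
  obtain B where B: "finite B" "\<And>x. \<exists>b\<in>span B. x - b \<in> Y" using assms(3) by (auto simp: finite_codim_def)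
  have "range x \<subseteq> sum_span Y B" using B(2) by (auto simp: sum_span_def)
  then show thesis using finite_quotient_compact[OF assms(1,2) B(1)] assms(4) that by blast
qed

text \<open>The case of the zero subspace in \<open>finite_quotient_compact\<close>: the correcting
  sequence vanishes, so the subsequence itself converges.\<close>

lemma finite_span_seq_compact:
  fixes V :: "'a::real_normed_vector set"
  assumes "V \<subseteq> span B" "finite B" "closed V" "bounded (range (x :: nat \<Rightarrow> 'a))" "range x \<subseteq> V"
  obtains r l where "strict_mono r" "(x \<circ> r) \<longlonglongrightarrow> l" "l \<in> V"
proof -
  have "range x \<subseteq> sum_span {0} B" using assms(1,5) by (auto simp: sum_span_def)
  then obtain r y l where "strict_mono r" "range y \<subseteq> {0}" "(\<lambda>n. x (r n) - y n) \<longlonglongrightarrow> l"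
    using finite_quotient_compact[of "{0}" B] assms(2,4) subspace_single_0 by blast
  moreover from this have "(x \<circ> r) \<longlonglongrightarrow> l" by (auto simp: o_def image_subset_iff)
  moreover from this have "l \<in> V" using assms(5) by (intro closed_sequentially[OF assms(3), of "x \<circ> r" l]) auto
  ultimately show thesis using that by blast
qed

text \<open>Induction on \<open>B\<close>: the functionals in \<open>V\<close> vanishing at
  \<open>b\<close> are separated by the other points, and one \<open>\<psi>\<close> with non-zero
  value at \<open>b\<close> supplies the missing dimension.\<close>

lemma functionals_separated_finite_span:
  fixes V :: "('a::real_normed_vector \<Rightarrow>\<^sub>L real) set"
  assumes "finite B" "subspace V" "\<And>\<phi>. \<phi> \<in> V \<Longrightarrow> (\<And>b. b \<in> B \<Longrightarrow> blinfun_apply \<phi> b = 0) \<Longrightarrow> \<phi> = 0"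
  shows "\<exists>S. finite S \<and> V \<subseteq> span S"
  using assms
proof (induction B arbitrary: V rule: finite_induct)
  case empty
  then have "V \<subseteq> span {}" by auto
  then show ?case by blast
next
  case (insert b B)
  define V' where "V' = {\<phi>\<in>V. blinfun_apply \<phi> b = 0}"
  have "subspace V'"
    using insert.prems(1) by (auto simp: subspace_def V'_def blinfun.add_left blinfun.scaleR_left)
  moreover have "\<phi> = 0" if "\<phi> \<in> V'" "\<And>c. c \<in> B \<Longrightarrow> blinfun_apply \<phi> c = 0" for \<phi>
    using that insert.prems(2)[of \<phi>] by (auto simp: V'_def)
  ultimately obtain S where S: "finite S" "V' \<subseteq> span S" using insert.IH[of V'] by blast
  show ?case
  proof (cases "V' = V")
    case True then show ?thesis using S by blast
  next
    case False
    then obtain \<psi> where \<psi>: "\<psi> \<in> V" "blinfun_apply \<psi> b \<noteq> 0" by (auto simp: V'_def)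
    have "V \<subseteq> span (insert \<psi> S)"
    proof
      fix \<phi> assume \<phi>: "\<phi> \<in> V"
      define c where "c = blinfun_apply \<phi> b / blinfun_apply \<psi> b"
      have "\<phi> - c *\<^sub>R \<psi> \<in> V'" using \<phi> \<psi> insert.prems(1)
        by (auto simp: V'_def c_def blinfun.diff_left blinfun.scaleR_left intro!: subspace_diff subspace_scale)
      then show "\<phi> \<in> span (insert \<psi> S)" using S(2) span_breakdown_eq by blast
    qed
    then show ?thesis using S(1) by blast
  qed
qed

section \<open>Annihilators and their finite dimension\<close>

lemma subspace_annihilator: "subspace (annihilator J)"
  by (auto simp: subspace_def annihilator_def blinfun.add_left blinfun.scaleR_left)

lemma closed_annihilator: "closed (annihilator J)"
proof -
  have "annihilator J = (\<Inter>x\<in>J. {\<phi>. blinfun_apply \<phi> x = 0})" by (auto simp: annihilator_def)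
  moreover have "closed {\<phi> :: 'a \<Rightarrow>\<^sub>L real. blinfun_apply \<phi> x = 0}" for x
    by (intro closed_Collect_eq continuous_intros)
  ultimately show ?thesis by auto
qed

lemma annihilator_mono: "Y \<subseteq> J \<Longrightarrow> annihilator J \<subseteq> annihilator Y"
  by (auto simp: annihilator_def)

text \<open>A functional vanishing on \<open>Y\<close> is determined by its values on a finite set
  that spans the space modulo \<open>Y\<close>.\<close>

lemma annihilator_finite_span:
  fixes Y :: "'a::real_normed_vector set"
  assumes "finite_codim Y"
  obtains S where "finite S" "annihilator Y \<subseteq> span S"
proof -
  obtain B where B: "finite B" "\<And>x. \<exists>b\<in>span B. x - b \<in> Y" using assms by (auto simp: finite_codim_def)
  have "\<phi> = 0" if \<phi>: "\<phi> \<in> annihilator Y" "\<And>b. b \<in> B \<Longrightarrow> blinfun_apply \<phi> b = 0" for \<phi>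
  proof (rule blinfun_eqI)
    fix x
    obtain b where b: "b \<in> span B" "x - b \<in> Y" using B(2) by blast
    have "blinfun_apply \<phi> b = 0"
      by (rule linear_eq_0_on_span[OF _ \<phi>(2) b(1)]) (rule bounded_linear.linear[OF blinfun.bounded_linear_right])
    then show "blinfun_apply \<phi> x = blinfun_apply 0 x"
      using \<phi>(1) b(2) by (auto simp: annihilator_def blinfun.diff_right)
  qed
  then show thesis using functionals_separated_finite_span[OF B(1) subspace_annihilator] that by blast
qed

section \<open>Representation by integrable functions\<close>

text \<open>The map \<open>\<rho>\<close> chooses one function from each class, which is why
  linearity and surjectivity only hold almost everywhere.\<close>

locale L1_representation =
  fixes M :: "'m measure" and \<rho> :: "'b::real_normed_vector \<Rightarrow> 'm \<Rightarrow> real"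
  assumes integrable_rep: "integrable M (\<rho> \<phi>)"
    and rep_add: "AE x in M. \<rho> (\<phi> + \<psi>) x = \<rho> \<phi> x + \<rho> \<psi> x"
    and rep_scale: "AE x in M. \<rho> (c *\<^sub>R \<phi>) x = c * \<rho> \<phi> x"
    and norm_rep: "norm \<phi> = (\<integral>x. \<bar>\<rho> \<phi> x\<bar> \<partial>M)"
    and rep_onto: "integrable M f \<Longrightarrow> \<exists>\<phi>. AE x in M. \<rho> \<phi> x = f x"

lemma L1_representation_exists:
  fixes M :: "'m measure" and T :: "'b::real_normed_vector \<Rightarrow> ('m \<Rightarrow> real) set"
  assumes "isometry_onto_L1 M T"
  obtains \<rho> :: "'b \<Rightarrow> 'm \<Rightarrow> real" where "L1_representation M \<rho>"
proof -
  have bij: "bij_betw T UNIV (L1_space M)"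
    and add: "\<And>u v f g. f \<in> T u \<Longrightarrow> g \<in> T v \<Longrightarrow> (\<lambda>x. f x + g x) \<in> T (u + v)"
    and scale: "\<And>c u f. f \<in> T u \<Longrightarrow> (\<lambda>x. c * f x) \<in> T (c *\<^sub>R u)"
    and norm: "\<And>u f. f \<in> T u \<Longrightarrow> (\<integral>x. \<bar>f x\<bar> \<partial>M) = norm u"
    using assms unfolding isometry_onto_L1_def by blast+
  have cls: "\<exists>f. integrable M f \<and> T u = L1_class M f" for u
  proof -
    have "T u \<in> L1_space M" using bij by (auto simp: bij_betw_def)
    then show ?thesis by (auto simp: L1_space_def)
  qed
  have ae: "AE x in M. f x = g x" if fg: "f \<in> T u" "g \<in> T u" for f g u
  proof -
    obtain k where "T u = L1_class M k" using cls by blast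
    then have "AE x in M. f x = k x" "AE x in M. g x = k x" using fg by (auto simp: L1_class_def)
    then show ?thesis by eventually_elim simp
  qed
  have "\<forall>u. \<exists>f. f \<in> T u"
  proof
    fix u
    obtain f where "integrable M f" "T u = L1_class M f" using cls by blast
    then have "f \<in> T u" by (simp add: L1_class_def)
    then show "\<exists>f. f \<in> T u" by blast
  qed
  then obtain \<rho> where \<rho>: "\<And>u. \<rho> u \<in> T u" by metis
  show thesis
  proof (rule that[of \<rho>], unfold_locales)
    fix \<phi> \<psi> :: 'b and c :: real and f :: "'m \<Rightarrow> real"
    show "integrable M (\<rho> \<phi>)" using cls[of \<phi>] \<rho>[of \<phi>] by (auto simp: L1_class_def)
    show "AE x in M. \<rho> (\<phi> + \<psi>) x = \<rho> \<phi> x + \<rho> \<psi> x" using ae[OF \<rho> add[OF \<rho> \<rho>]] .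
    show "AE x in M. \<rho> (c *\<^sub>R \<phi>) x = c * \<rho> \<phi> x" using ae[OF \<rho> scale[OF \<rho>]] .
    show "norm \<phi> = (\<integral>x. \<bar>\<rho> \<phi> x\<bar> \<partial>M)" using norm[OF \<rho>] by simp
    assume f: "integrable M f"
    then have "L1_class M f \<in> L1_space M" by (auto simp: L1_space_def)
    then obtain u where "T u = L1_class M f" using bij unfolding bij_betw_def by (metis imageE)
    then show "\<exists>\<phi>. AE x in M. \<rho> \<phi> x = f x" using \<rho>[of u] by (auto simp: L1_class_def)
  qed
qed

text \<open>The part \<open>t\<close> of the sum \<open>(\<Sum>i\<in>I. F i)\<close> is shared out among the terms with the sign of \<open>t\<close>, in
  proportion to their size. A vanishing denominator only occurs together with a vanishing numerator.\<close>

definition share :: "'i set \<Rightarrow> ('i \<Rightarrow> real) \<Rightarrow> real \<Rightarrow> 'i \<Rightarrow> real" where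
  "share I F t i = (if t > 0 then t * (max 0 (F i) / (\<Sum>j\<in>I. max 0 (F j)))
     else t * (max 0 (- F i) / (\<Sum>j\<in>I. max 0 (- F j))))"

text \<open>This domination makes the shares integrable in
  \<open>riesz_decomposition\<close>.\<close>

lemma abs_share_le:
  assumes "finite I" "i \<in> I"
  shows "\<bar>share I F t i\<bar> \<le> \<bar>t\<bar>"
proof -
  have *: "\<bar>t * (max 0 (G i) / (\<Sum>j\<in>I. max 0 (G j)))\<bar> \<le> \<bar>t\<bar>" for G :: "'a \<Rightarrow> real"
  proof -
    have "\<bar>max 0 (G i) / (\<Sum>j\<in>I. max 0 (G j))\<bar> \<le> 1"
    proof -
    have "max 0 (G i) \<le> (\<Sum>j\<in>I. max 0 (G j))" by (rule member_le_sum[OF assms(2) _ assms(1)]) simp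
    moreover from this have "0 \<le> (\<Sum>j\<in>I. max 0 (G j))" by (rule order_trans[rotated]) simp
    ultimately show ?thesis by (auto simp: divide_le_eq_1 simp del: max.bounded_iff)
    qed
    from mult_left_mono[OF this, of "\<bar>t\<bar>"] show ?thesis by (simp only: abs_mult mult_1_right abs_ge_zero)
  qed
  show ?thesis
  proof (cases "t > 0")
    case True
    then show ?thesis using *[of F] by (simp only: share_def if_True)
  next
    case False
    then show ?thesis using *[of "\<lambda>j. - F j"] by (simp only: share_def if_False)
  qed
qed

text \<open>Since \<open>t\<close> is at most the sum of the \<open>F i\<close>, it is at most the
  sum \<open>S\<close> of their positive parts; hence each positive part is multiplied by a factor
  \<open>t / S\<close> of at most 1.\<close>

lemma share_pos:
  assumes I: "finite I" and t: "0 < t" "t \<le> (\<Sum>i\<in>I. F i)"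
  shows "(\<Sum>i\<in>I. share I F t i) = t" "i \<in> I \<Longrightarrow> 0 \<le> share I F t i"
    "i \<in> I \<Longrightarrow> share I F t i \<le> max 0 (F i)"
proof -
  define S where "S = (\<Sum>j\<in>I. max 0 (F j))"
  have "(\<Sum>i\<in>I. F i) \<le> S" unfolding S_def by (intro sum_mono) simp
  then have S: "t \<le> S" "S > 0" using t by auto
  have sh: "share I F t i = t * (max 0 (F i) / S)" for i using t by (simp add: share_def S_def)
  show "(\<Sum>i\<in>I. share I F t i) = t"
    using S(2) by (simp add: sh flip: sum_distrib_left sum_divide_distrib S_def)
  assume "i \<in> I"
  show "0 \<le> share I F t i" using t S by (simp add: sh)
  have "t * max 0 (F i) \<le> S * max 0 (F i)" using S(1) by (intro mult_right_mono) auto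
  then show "share I F t i \<le> max 0 (F i)" using S(2) by (simp add: sh field_simps)
qed

text \<open>The hypothesis says that \<open>t\<close> lies between 0 and the sum. A negative
  \<open>t\<close> is reduced to \<open>share_pos\<close> by changing the signs of \<open>t\<close>
  and of all \<open>F i\<close>.\<close>

lemma share_properties:
  assumes I: "finite I" and t: "0 \<le> t * ((\<Sum>i\<in>I. F i) - t)"
  shows "(\<Sum>i\<in>I. share I F t i) = t" "(\<Sum>i\<in>I. \<bar>share I F t i\<bar>) = \<bar>t\<bar>"
    "i \<in> I \<Longrightarrow> 0 \<le> share I F t i * (F i - share I F t i)"
proof -
  consider "t = 0" | "0 < t" "t \<le> (\<Sum>i\<in>I. F i)" | "0 < - t" "- t \<le> (\<Sum>i\<in>I. - F i)"
    using t by (cases t "0 :: real" rule: linorder_cases) (auto simp: zero_le_mult_iff sum_negf)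
  then have "(\<Sum>i\<in>I. share I F t i) = t \<and> (\<Sum>i\<in>I. \<bar>share I F t i\<bar>) = \<bar>t\<bar> \<and>
    (\<forall>i\<in>I. 0 \<le> share I F t i * (F i - share I F t i))"
  proof cases
    case 1 then show ?thesis by (simp add: share_def)
  next
    case 2
    note sh = share_pos[OF I 2]
    have "0 \<le> share I F t i * (F i - share I F t i)" if "i \<in> I" for i
    proof (cases "0 \<le> F i")
      case False
      then have "share I F t i = 0" using sh(2,3)[OF that] by simp
      then show ?thesis by simp
    qed (use sh(2,3)[OF that] in simp)
    then show ?thesis using sh 2 by simp
  next
    case 3
    note sh = share_pos[OF I 3]
    have eq: "share I F t i = - share I (\<lambda>i. - F i) (- t) i" for i using 3 by (simp add: share_def)
    have "0 \<le> share I F t i * (F i - share I F t i)" if "i \<in> I" for i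
    proof (cases "F i \<le> 0")
      case False
      then have "share I F t i = 0" using sh(2,3)[OF that] by (simp add: eq)
      then show ?thesis by simp
    qed (use sh(2,3)[OF that] in \<open>simp add: eq mult_nonneg_nonpos\<close>)
    then show ?thesis using sh 3 by (simp add: eq sum_negf)
  qed
  then show "(\<Sum>i\<in>I. share I F t i) = t" "(\<Sum>i\<in>I. \<bar>share I F t i\<bar>) = \<bar>t\<bar>"
    "i \<in> I \<Longrightarrow> 0 \<le> share I F t i * (F i - share I F t i)" by auto
qed

section \<open>Norm-additive decompositions in the space of integrable functions\<close>

context L1_representation
begin

lemma rep_diff: "AE x in M. \<rho> (\<phi> - \<psi>) x = \<rho> \<phi> x - \<rho> \<psi> x"
  using rep_add[of "\<phi> - \<psi>" \<psi>] by eventually_elim simp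

lemma rep_zero: "AE x in M. \<rho> 0 x = 0"
  using rep_scale[of 0 0] by simp

lemma rep_sum:
  assumes "finite I"
  shows "AE x in M. \<rho> (\<Sum>i\<in>I. \<phi> i) x = (\<Sum>i\<in>I. \<rho> (\<phi> i) x)"
  using assms
proof induction
  case empty then show ?case using rep_zero by simp
next
  case (insert i I)
  from insert.IH rep_add[of "\<phi> i" "\<Sum>i\<in>I. \<phi> i"] show ?case
    by eventually_elim (simp add: insert.hyps)
qed

lemma norm_eq_integral:
  assumes "AE x in M. \<rho> \<phi> x = f x" "integrable M f"
  shows "norm \<phi> = (\<integral>x. \<bar>f x\<bar> \<partial>M)"
  unfolding norm_rep
  using assms integrable_rep[of \<phi>] by (intro integral_cong_AE) auto

lemma rep_inject:
  assumes "AE x in M. \<rho> \<phi> x = \<rho> \<psi> x"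
  shows "\<phi> = \<psi>"
proof -
  have "AE x in M. \<rho> (\<phi> - \<psi>) x = 0" using rep_diff[of \<phi> \<psi>] assms by eventually_elim simp
  then have "norm (\<phi> - \<psi>) = 0" by (subst norm_eq_integral) auto
  then show ?thesis by simp
qed

text \<open>The pointwise defect \<open>d\<close> of the triangle inequality is non-negative, so its
  integral vanishes only if \<open>d\<close> does almost everywhere, that is, if the two values
  never have opposite signs. Identities of norms thereby become pointwise statements.\<close>

lemma norm_add_eq_iff:
  "norm (\<phi> + \<psi>) = norm \<phi> + norm \<psi> \<longleftrightarrow> (AE x in M. 0 \<le> \<rho> \<phi> x * \<rho> \<psi> x)"
proof -
  have [simp]: "integrable M (\<rho> \<phi>)" for \<phi> by (rule integrable_rep)
  define d where "d = (\<lambda>x. \<bar>\<rho> \<phi> x\<bar> + \<bar>\<rho> \<psi> x\<bar> - \<bar>\<rho> \<phi> x + \<rho> \<psi> x\<bar>)"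
  have d: "integrable M d" "\<And>x. 0 \<le> d x" by (auto simp: d_def)
  have "norm \<phi> + norm \<psi> - norm (\<phi> + \<psi>) = (\<integral>x. d x \<partial>M)"
    unfolding d_def by (simp add: norm_eq_integral[OF rep_add] norm_rep[of \<phi>] norm_rep[of \<psi>])
  then have "norm (\<phi> + \<psi>) = norm \<phi> + norm \<psi> \<longleftrightarrow> (AE x in M. d x = 0)"
    using integral_nonneg_eq_0_iff_AE[OF d(1)] d(2) by (simp add: algebra_simps)
  moreover have "d x = 0 \<longleftrightarrow> 0 \<le> \<rho> \<phi> x * \<rho> \<psi> x" for x
    by (auto simp: d_def zero_le_mult_iff abs_if)
  ultimately show ?thesis by simp
qed

text \<open>The remainder after removing \<open>h\<close> from the sum is shared out pointwise by
  \<open>share\<close>. The shares have the sign of the remainder, so their norms add up to its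
  norm. The complements \<open>f i - k i\<close> then sum to \<open>h\<close>.\<close>

lemma riesz_decomposition:
  fixes f :: "'i \<Rightarrow> 'b"
  assumes I: "finite I" and h: "norm (\<Sum>i\<in>I. f i) = norm h + norm ((\<Sum>i\<in>I. f i) - h)"
  obtains k where "(\<Sum>i\<in>I. k i) = (\<Sum>i\<in>I. f i) - h"
    "\<And>i. i \<in> I \<Longrightarrow> norm (f i) = norm (k i) + norm (f i - k i)"
    "(\<Sum>i\<in>I. norm (k i)) = norm ((\<Sum>i\<in>I. f i) - h)"
proof -
  define s where "s = (\<Sum>i\<in>I. f i)"
  define F where "F x i = \<rho> (f i) x" for x i
  define t where "t = \<rho> (s - h)"
  have [simp]: "integrable M (\<rho> \<phi>)" for \<phi> by (rule integrable_rep)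
  have [measurable]: "(\<lambda>x. F x i) \<in> borel_measurable M" "t \<in> borel_measurable M" for i
    unfolding F_def t_def using integrable_rep by (auto intro: borel_measurable_integrable)
  have int: "integrable M (\<lambda>x. share I (F x) (t x) i)" if "i \<in> I" for i
  proof (rule Bochner_Integration.integrable_bound)
    show "integrable M t" by (simp add: t_def)
    show "(\<lambda>x. share I (F x) (t x) i) \<in> borel_measurable M" unfolding share_def by measurable
    show "AE x in M. norm (share I (F x) (t x) i) \<le> norm (t x)"
      using abs_share_le[OF I that] by simp
  qed
  then have "\<forall>i\<in>I. \<exists>\<phi>. AE x in M. \<rho> \<phi> x = share I (F x) (t x) i" using rep_onto by blast
  then obtain k where k: "\<And>i. i \<in> I \<Longrightarrow> AE x in M. \<rho> (k i) x = share I (F x) (t x) i" by metis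
  have "norm (h + (s - h)) = norm h + norm (s - h)" using h by (simp add: s_def)
  then have "AE x in M. 0 \<le> \<rho> h x * t x" unfolding norm_add_eq_iff t_def .
  then have pos: "AE x in M. 0 \<le> t x * ((\<Sum>i\<in>I. F x i) - t x)"
    using rep_diff[of s h] rep_sum[OF I, of f]
    by eventually_elim (simp add: F_def t_def s_def mult.commute)
  have kall: "AE x in M. \<forall>i\<in>I. \<rho> (k i) x = share I (F x) (t x) i"
    using k I by (intro AE_finite_allI) auto
  show thesis
  proof (rule that[of k])
    show "(\<Sum>i\<in>I. k i) = (\<Sum>i\<in>I. f i) - h"
    proof (rule rep_inject)
      from kall pos rep_sum[OF I, of k]
      show "AE x in M. \<rho> (\<Sum>i\<in>I. k i) x = \<rho> ((\<Sum>i\<in>I. f i) - h) x"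
        by eventually_elim (simp add: share_properties(1)[OF I] flip: s_def t_def)
    qed
    show "norm (f i) = norm (k i) + norm (f i - k i)" if i: "i \<in> I" for i
    proof -
      have "AE x in M. 0 \<le> \<rho> (k i) x * \<rho> (f i - k i) x"
        using k[OF i] pos rep_diff[of "f i" "k i"]
      proof eventually_elim
        case (elim x)
        then show ?case using share_properties(3)[OF I elim(2) i] by (simp flip: F_def)
      qed
      then show ?thesis using norm_add_eq_iff[of "k i" "f i - k i"] by simp
    qed
    have "(\<Sum>i\<in>I. norm (k i)) = (\<integral>x. (\<Sum>i\<in>I. \<bar>share I (F x) (t x) i\<bar>) \<partial>M)"
      using int by (simp add: norm_eq_integral[OF k])
    also have "\<dots> = (\<integral>x. \<bar>t x\<bar> \<partial>M)"
    proof (rule integral_cong_AE)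
      show "(\<lambda>x. \<Sum>i\<in>I. \<bar>share I (F x) (t x) i\<bar>) \<in> borel_measurable M"
        unfolding share_def by measurable
      from pos show "AE x in M. (\<Sum>i\<in>I. \<bar>share I (F x) (t x) i\<bar>) = \<bar>t x\<bar>"
        by eventually_elim (rule share_properties(2)[OF I])
    qed measurable
    also have "\<dots> = norm ((\<Sum>i\<in>I. f i) - h)" by (simp add: t_def norm_rep s_def)
    finally show "(\<Sum>i\<in>I. norm (k i)) = norm ((\<Sum>i\<in>I. f i) - h)" .
  qed
qed

text \<open>\<open>h\<^sub>2\<close> is the restriction of \<open>h\<close> to the set where \<open>s / h < 1 / 2\<close>.\<close>

lemma small_splitting:
  fixes s h :: 'b
  obtains h\<^sub>2 where "norm h\<^sub>2 \<le> 2 * norm (s - h)" "norm h = norm (h - h\<^sub>2) + norm h\<^sub>2"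
    "\<And>j. norm (h + j) = norm h + norm j \<Longrightarrow> norm (h - j) = norm h + norm j \<Longrightarrow>
      norm (h - 2 *\<^sub>R h\<^sub>2 - j) = norm h + norm j"
    "h\<^sub>2 = 0 \<Longrightarrow> norm s = norm ((1 / 2) *\<^sub>R h) + norm (s - (1 / 2) *\<^sub>R h)"
proof -
  have [simp]: "integrable M (\<rho> \<phi>)" for \<phi> by (rule integrable_rep)
  have [measurable]: "\<rho> \<phi> \<in> borel_measurable M" for \<phi>
    using integrable_rep by (rule borel_measurable_integrable)
  define A where "A = {x\<in>space M. \<rho> h x * \<rho> s x < (\<rho> h x)\<^sup>2 / 2}"
  have [measurable]: "A \<in> sets M" unfolding A_def by measurable
  define a where "a x = indicat_real A x * \<rho> h x" for x
  have a: "integrable M a" unfolding a_def by (rule integrable_mult_indicator[where 'b=real, simplified]) simp_all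
  then obtain h\<^sub>2 where h2: "AE x in M. \<rho> h\<^sub>2 x = a x" using rep_onto by blast
  have a01: "a x = 0 \<or> a x = \<rho> h x" for x by (simp add: a_def indicator_def)
  show thesis
  proof (rule that[of h\<^sub>2])
    have "norm h\<^sub>2 = (\<integral>x. \<bar>a x\<bar> \<partial>M)" by (rule norm_eq_integral[OF h2 a])
    also have "\<dots> \<le> (\<integral>x. 2 * \<bar>\<rho> s x - \<rho> h x\<bar> \<partial>M)"
    proof (rule integral_mono)
      fix x
      show "\<bar>a x\<bar> \<le> 2 * \<bar>\<rho> s x - \<rho> h x\<bar>"
      proof (cases "x \<in> A")
        case True
        \<comment> \<open>On \<open>A\<close> the defining inequality reads
          \<open>h\<^sup>2 < 2 h (h - s)\<close> pointwise; cancelling \<open>\<bar>h\<bar>\<close>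
          bounds \<open>h\<close> by twice the distance from \<open>s\<close>.\<close>
        then have "\<bar>\<rho> h x\<bar> * \<bar>\<rho> h x\<bar> < 2 * (\<rho> h x * (\<rho> h x - \<rho> s x))"
          by (simp add: A_def power2_eq_square algebra_simps)
        also have "\<dots> \<le> \<bar>\<rho> h x\<bar> * (2 * \<bar>\<rho> s x - \<rho> h x\<bar>)"
          using abs_ge_self[of "\<rho> h x * (\<rho> h x - \<rho> s x)"] by (simp add: abs_mult abs_minus_commute)
        finally have "\<bar>\<rho> h x\<bar> < 2 * \<bar>\<rho> s x - \<rho> h x\<bar>" by (rule mult_left_less_imp_less) simp
        then show ?thesis using True by (simp add: a_def)
      qed (simp add: a_def)
    qed (use a in auto)
    also have "\<dots> = 2 * norm (s - h)" by (simp add: norm_eq_integral[OF rep_diff])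
    finally show "norm h\<^sub>2 \<le> 2 * norm (s - h)" .
    have "AE x in M. 0 \<le> \<rho> (h - h\<^sub>2) x * \<rho> h\<^sub>2 x"
      using h2 rep_diff[of h h\<^sub>2] by eventually_elim (use a01 in \<open>metis diff_zero diff_self mult_zero_left mult_zero_right order_refl\<close>)
    then show split: "norm h = norm (h - h\<^sub>2) + norm h\<^sub>2" using norm_add_eq_iff[of "h - h\<^sub>2" h\<^sub>2] by simp
    \<comment> \<open>Subtracting twice the restriction flips the sign of \<open>h\<close> on
      \<open>A\<close> and leaves absolute values unchanged.\<close>
    have "AE x in M. \<bar>\<rho> (h - 2 *\<^sub>R h\<^sub>2) x\<bar> = \<bar>\<rho> h x\<bar>"
      using h2 rep_diff[of h "2 *\<^sub>R h\<^sub>2"] rep_scale[of 2 h\<^sub>2]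
    proof eventually_elim
      case (elim x)
      then show ?case using a01[of x] by auto
    qed
    then have n: "norm (h - 2 *\<^sub>R h\<^sub>2) = norm h"
      unfolding norm_rep by (intro integral_cong_AE) auto
    show "norm (h - 2 *\<^sub>R h\<^sub>2 - j) = norm h + norm j"
      if j: "norm (h + j) = norm h + norm j" "norm (h - j) = norm h + norm j" for j
    proof -
      \<comment> \<open>Norm additivity for both \<open>j\<close> and \<open>- j\<close> forces the
        product of \<open>h\<close> and \<open>j\<close> to vanish almost everywhere, a property
        that survives the sign flip.\<close>
      have "norm (h + (- j)) = norm h + norm (- j)" using j(2) by simp
      then have "AE x in M. 0 \<le> \<rho> h x * \<rho> (- j) x" by (simp only: norm_add_eq_iff)
      moreover have "AE x in M. 0 \<le> \<rho> h x * \<rho> j x" using j(1) by (simp only: norm_add_eq_iff)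
      moreover have "AE x in M. \<rho> (- j) x = - \<rho> j x" using rep_scale[of "- 1" j] by simp
      ultimately have "AE x in M. 0 \<le> \<rho> (h - 2 *\<^sub>R h\<^sub>2) x * \<rho> (- j) x"
        using h2 rep_diff[of h "2 *\<^sub>R h\<^sub>2"] rep_scale[of 2 h\<^sub>2]
      proof eventually_elim
        case (elim x)
        then have "\<rho> h x * \<rho> j x = 0" by simp
        then show ?case using a01[of x] elim by auto
      qed
      then show ?thesis using norm_add_eq_iff[of "h - 2 *\<^sub>R h\<^sub>2" "- j"] n by simp
    qed
    assume h20: "h\<^sub>2 = 0"
    have "AE x in M. 0 \<le> \<rho> ((1 / 2) *\<^sub>R h) x * \<rho> (s - (1 / 2) *\<^sub>R h) x"
      using h2 rep_zero rep_scale[of "1 / 2" h] rep_diff[of s "(1 / 2) *\<^sub>R h"] AE_space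
    proof eventually_elim
      case (elim x)
      then have "a x = 0" by (simp add: h20)
      then have "\<rho> h x * \<rho> s x \<ge> (\<rho> h x)\<^sup>2 / 2"
        using elim(5) by (cases "x \<in> A") (auto simp: a_def A_def)
      then have "0 \<le> 1 / 2 * \<rho> h x * (\<rho> s x - 1 / 2 * \<rho> h x)"
        by (simp add: power2_eq_square algebra_simps)
      then show ?case by (simp add: elim(3,4))
    qed
    then show "norm s = norm ((1 / 2) *\<^sub>R h) + norm (s - (1 / 2) *\<^sub>R h)"
      using norm_add_eq_iff[of "(1 / 2) *\<^sub>R h" "s - (1 / 2) *\<^sub>R h"] by simp
  qed
qed

end

section \<open>Approximate centres\<close>

lemma far_radius_le_iff:
  assumes "bounded F" "F \<noteq> {}"
  shows "far_radius v F \<le> c \<longleftrightarrow> (\<forall>z\<in>F. norm (v - z) \<le> c)"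
proof -
  obtain M where "\<And>z. z \<in> F \<Longrightarrow> norm z \<le> M" using assms(1) by (auto simp: bounded_iff)
  then have "bdd_above ((\<lambda>z. norm (v - z)) ` F)"
    by (intro bdd_aboveI2[of _ _ "norm v + M"]) (metis norm_triangle_ineq4 add_left_mono order_trans)
  then show ?thesis unfolding far_radius_def by (intro cSUP_le_iff assms(2))
qed

lemma far_radius_nonneg:
  assumes "bounded F" "F \<noteq> {}"
  shows "0 \<le> far_radius v F"
proof -
  obtain z where "z \<in> F" using assms(2) by blast
  then have "norm (v - z) \<le> far_radius v F" using far_radius_le_iff[OF assms, of v "far_radius v F"] by simp
  then show ?thesis using norm_ge_zero order_trans by blast
qed

lemma rad_le_far_radius:
  assumes "bounded F" "F \<noteq> {}" "v \<in> V"
  shows "rad V F \<le> far_radius v F"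
  unfolding rad_def using far_radius_nonneg[OF assms(1,2)] assms(3)
  by (intro cINF_lower bdd_belowI2[of _ 0]) auto

lemma rad_nonneg:
  assumes "bounded F" "F \<noteq> {}" "V \<noteq> {}"
  shows "0 \<le> rad V F"
  unfolding rad_def using assms(3) by (intro cINF_greatest far_radius_nonneg assms)

lemma approx_cent_nonempty:
  assumes "V \<noteq> {}" "\<delta> > 0"
  shows "approx_cent V F \<delta> \<noteq> {}"
proof -
  have "\<exists>x\<in>(\<lambda>v. far_radius v F) ` V. x < rad V F + \<delta>"
    using assms unfolding rad_def by (intro cInf_lessD) auto
  then show ?thesis by (force simp: approx_cent_def)
qed

lemma approx_cent_iff:
  assumes "bounded F" "F \<noteq> {}"
  shows "v \<in> approx_cent V F \<delta> \<longleftrightarrow> v \<in> V \<and> (\<forall>z\<in>F. norm (v - z) \<le> rad V F + \<delta>)"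
  by (simp add: approx_cent_def far_radius_le_iff[OF assms])

lemma cent_iff:
  assumes "bounded F" "F \<noteq> {}"
  shows "v \<in> cent V F \<longleftrightarrow> v \<in> V \<and> (\<forall>z\<in>F. norm (v - z) \<le> rad V F)"
  using rad_le_far_radius[OF assms, of v V] far_radius_le_iff[OF assms, of v "rad V F"]
  by (auto simp: cent_def)

text \<open>In \<open>improve\<close> the number \<open>\<delta>\<close> is chosen before
  \<open>\<eta>\<close>. A point can therefore be moved successively into approximate centres of
  tolerance \<open>\<delta> n\<close>, the \<open>n\<close>-th move costing at most
  \<open>\<epsilon> / 2 ^ Suc n\<close>; the limit is an exact centre.\<close>

lemma cent_near_approx_cent:
  fixes V :: "'a::banach set"
  assumes V: "closed V" and F: "bounded F" "F \<noteq> {}" and \<epsilon>: "\<epsilon> > 0"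
    and improve: "\<And>e. e > 0 \<Longrightarrow> \<exists>\<delta>>0. \<forall>\<eta>>0. \<forall>v\<in>approx_cent V F \<delta>. \<exists>w\<in>approx_cent V F \<eta>. norm (v - w) \<le> e"
  shows "\<exists>\<delta>>0. \<forall>v\<in>approx_cent V F \<delta>. \<exists>c\<in>cent V F. norm (v - c) \<le> \<epsilon>"
proof -
  have "\<forall>n. \<exists>\<delta>>0. \<forall>\<eta>>0. \<forall>v\<in>approx_cent V F \<delta>. \<exists>w\<in>approx_cent V F \<eta>. norm (v - w) \<le> \<epsilon> / 2 ^ Suc n"
    using \<epsilon> by (intro allI improve) simp
  then obtain D where D: "\<And>n. D n > 0"
    "\<And>n \<eta> v. \<eta> > 0 \<Longrightarrow> v \<in> approx_cent V F (D n) \<Longrightarrow> \<exists>w\<in>approx_cent V F \<eta>. norm (v - w) \<le> \<epsilon> / 2 ^ Suc n"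
    by metis
  \<comment> \<open>\<open>D n\<close> permits the next move; the second bound makes the tolerances
    tend to 0.\<close>
  define \<delta> where "\<delta> n = min (D n) (1 / real (Suc n))" for n
  have \<delta>: "\<delta> n > 0" for n using D(1) by (simp add: \<delta>_def)
  have mono: "v \<in> approx_cent V F b" if "v \<in> approx_cent V F a" "a \<le> b" for v a b
    using that by (auto simp: approx_cent_def)
  show ?thesis
  proof (intro exI[of _ "\<delta> 0"] conjI ballI \<delta>)
    fix v assume v: "v \<in> approx_cent V F (\<delta> 0)"
    have "\<exists>w. w 0 = v \<and> (\<forall>n. w n \<in> approx_cent V F (\<delta> n) \<and> norm (w n - w (Suc n)) \<le> \<epsilon> / 2 ^ Suc n)"
    proof -
      \<comment> \<open>The conjunct for \<open>n = 0\<close> makes the chosen sequence start at the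
        given \<open>v\<close>.\<close>
      have "\<exists>w. \<forall>n. (w n \<in> approx_cent V F (\<delta> n) \<and> (n = 0 \<longrightarrow> w n = v)) \<and>
          norm (w n - w (Suc n)) \<le> \<epsilon> / 2 ^ Suc n"
      proof (rule dependent_nat_choice)
        show "\<exists>x. x \<in> approx_cent V F (\<delta> 0) \<and> (0 = (0::nat) \<longrightarrow> x = v)" using v by blast
        fix x and n :: nat assume "x \<in> approx_cent V F (\<delta> n) \<and> (n = 0 \<longrightarrow> x = v)"
        then have "x \<in> approx_cent V F (D n)" by (auto simp: \<delta>_def intro: mono)
        from D(2)[OF \<delta>[of "Suc n"] this]
        show "\<exists>y. (y \<in> approx_cent V F (\<delta> (Suc n)) \<and> (Suc n = 0 \<longrightarrow> y = v)) \<and> norm (x - y) \<le> \<epsilon> / 2 ^ Suc n"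
          by auto
      qed
      then show ?thesis by auto
    qed
    then obtain w where w: "w 0 = v" "\<And>n. w n \<in> approx_cent V F (\<delta> n)"
      "\<And>n. norm (w n - w (Suc n)) \<le> \<epsilon> / 2 ^ Suc n" by blast
    \<comment> \<open>The right-hand side is the geometric sum of the moves from \<open>n\<close> to
      \<open>m - 1\<close> in closed form.\<close>
    have step: "norm (w n - w m) \<le> \<epsilon> / 2 ^ n - \<epsilon> / 2 ^ m" if "n \<le> m" for n m
      using that
    proof (induction m rule: dec_induct)
      case (step m)
      have "norm (w n - w (Suc m)) \<le> norm (w n - w m) + norm (w m - w (Suc m))"
        using norm_triangle_ineq[of "w n - w m" "w m - w (Suc m)"] by simp
      moreover have "\<epsilon> / 2 ^ Suc m = \<epsilon> / 2 ^ m - \<epsilon> / 2 ^ Suc m" by simp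
      ultimately show ?case using step.IH w(3)[of m] by linarith
    qed simp
    have step': "norm (w n - w m) \<le> \<epsilon> / 2 ^ n" if "n \<le> m" for n m
      using step[OF that] \<epsilon> by (smt (verit) divide_nonneg_pos zero_less_power)
    have "Cauchy w"
    proof (rule CauchyI')
      fix e :: real assume e: "e > 0"
      have "(\<lambda>n. \<epsilon> / 2 ^ n) \<longlonglongrightarrow> 0"
        using LIMSEQ_divide_realpow_zero[of 2 \<epsilon>] by simp
      then obtain N where N: "\<And>n. n \<ge> N \<Longrightarrow> \<epsilon> / 2 ^ n < e"
        using e \<epsilon> by (auto simp: LIMSEQ_iff)
      show "\<exists>N. \<forall>m\<ge>N. \<forall>n>m. dist (w m) (w n) < e"
      proof (intro exI allI impI)
        fix m n assume "m \<ge> N" "n > m"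
        then show "dist (w m) (w n) < e"
          using N[of m] step'[of m n] by (simp add: dist_norm)
      qed
    qed
    then obtain l where l: "w \<longlonglongrightarrow> l" using Cauchy_convergent_iff convergent_def by blast
    have "l \<in> V" using w(2) by (intro closed_sequentially[OF V _ l]) (simp add: approx_cent_def)
    moreover have "norm (l - z) \<le> rad V F" if z: "z \<in> F" for z
    proof (rule LIMSEQ_le)
      show "(\<lambda>n. norm (w n - z)) \<longlonglongrightarrow> norm (l - z)" by (intro tendsto_intros l)
      show "(\<lambda>n. rad V F + 1 / real (Suc n)) \<longlonglongrightarrow> rad V F"
        using tendsto_add[OF tendsto_const LIMSEQ_inverse_real_of_nat] by (simp add: inverse_eq_divide)
      have "norm (w n - z) \<le> rad V F + 1 / real (Suc n)" for n
      proof -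
        have "norm (w n - z) \<le> rad V F + \<delta> n" using w(2)[of n] z by (simp add: approx_cent_iff[OF F])
        also have "\<delta> n \<le> 1 / real (Suc n)" by (simp add: \<delta>_def)
        finally show ?thesis by simp
      qed
      then show "\<exists>N. \<forall>n\<ge>N. norm (w n - z) \<le> rad V F + 1 / real (Suc n)" by blast
    qed
    ultimately have "l \<in> cent V F" by (simp add: cent_iff[OF F])
    moreover have "norm (v - l) \<le> \<epsilon>"
    proof (rule LIMSEQ_le_const2)
      show "(\<lambda>n. norm (v - w n)) \<longlonglongrightarrow> norm (v - l)" by (intro tendsto_intros l)
      show "\<exists>N. \<forall>n\<ge>N. norm (v - w n) \<le> \<epsilon>" using step'[of 0] w(1) by auto
    qed
    ultimately show "\<exists>c\<in>cent V F. norm (v - c) \<le> \<epsilon>" by blast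
  qed
qed

text \<open>Approximate centres always exist, so their closeness to exact centres also shows that
  the latter exist.\<close>

lemma property_P1_UNIV_I:
  fixes V :: "'a::banach set"
  assumes V: "closed V" "V \<noteq> {}" and F: "\<And>F. F \<in> \<F> \<Longrightarrow> bounded F \<and> F \<noteq> {}"
    and improve: "\<And>F e. F \<in> \<F> \<Longrightarrow> e > 0 \<Longrightarrow>
      \<exists>\<delta>>0. \<forall>\<eta>>0. \<forall>v\<in>approx_cent V F \<delta>. \<exists>w\<in>approx_cent V F \<eta>. norm (v - w) \<le> e"
  shows "property_P1 UNIV V \<F>"
proof -
  have near: "\<exists>\<delta>>0. \<forall>v\<in>approx_cent V F \<delta>. \<exists>c\<in>cent V F. norm (v - c) \<le> \<epsilon>" if "F \<in> \<F>" "\<epsilon> > 0" for F \<epsilon>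
    using F[OF that(1)] improve[OF that(1)] that(2) by (intro cent_near_approx_cent V) auto
  show ?thesis
    unfolding property_P1_def
  proof (intro conjI ballI allI impI)
    fix F assume "F \<in> \<F>"
    then obtain \<delta> :: real where \<delta>: "\<delta> > 0" "\<forall>v\<in>approx_cent V F \<delta>. \<exists>c\<in>cent V F. norm (v - c) \<le> 1"
      using near[of F 1] by auto
    then show "cent V F \<noteq> {}" using approx_cent_nonempty[OF V(2) \<delta>(1), of F] by auto
  next
    fix \<epsilon> :: real and F assume \<epsilon>: "\<epsilon> > 0" and "F \<in> \<F>"
    then obtain \<delta> :: real where \<delta>: "\<delta> > 0" "\<forall>v\<in>approx_cent V F \<delta>. \<exists>c\<in>cent V F. norm (v - c) \<le> \<epsilon>"
      using near[of F \<epsilon>] by auto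
    have "\<exists>c b. v = c + \<epsilon> *\<^sub>R b \<and> c \<in> cent V F \<and> b \<in> cball 0 1 \<inter> UNIV" if v: "v \<in> approx_cent V F \<delta>" for v
    proof -
      obtain c where c: "c \<in> cent V F" "norm (v - c) \<le> \<epsilon>" using \<delta>(2) v by blast
      have "v = c + \<epsilon> *\<^sub>R ((1 / \<epsilon>) *\<^sub>R (v - c))" "norm ((1 / \<epsilon>) *\<^sub>R (v - c)) \<le> 1"
        using \<epsilon> c(2) by simp_all
      then show ?thesis using c(1) by (metis IntI UNIV_I mem_cball_0)
    qed
    then show "\<exists>\<delta>>0. approx_cent V F \<delta> \<subseteq> {c + \<epsilon> *\<^sub>R b | c b. c \<in> cent V F \<and> b \<in> cball 0 1 \<inter> UNIV}"
      using \<delta>(1) by blast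
  qed
qed

section \<open>Parts of functionals near the annihilator\<close>

text \<open>Otherwise some \<open>x n\<close> in the unit ball of \<open>J\<close> almost norm
  \<open>h\<close> but stay far from its norming points. Modulo \<open>Y\<close> a subsequence
  converges to some \<open>w\<close> with \<open>h w = norm h\<close>. This \<open>w\<close> has
  distance 1 from \<open>Y\<close>, and the \<open>- y n\<close> are almost best approximations to
  it. Strong proximinality yields a best approximation \<open>c\<close> near \<open>- y n\<close>,
  and \<open>w - c\<close> is a norming point near \<open>x (r n)\<close>.\<close>

lemma strongly_proximinal_norming:
  fixes Y J :: "'a::real_normed_vector set" and h :: "'a \<Rightarrow>\<^sub>L real"
  assumes Y: "subspace Y" "closed Y" "finite_codim Y" and J: "subspace J" "closed J" "Y \<subseteq> J"
    and sp: "strongly_proximinal J Y" and h: "h \<in> annihilator Y"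
  shows "\<exists>d>0. \<forall>x\<in>J. norm x \<le> 1 \<longrightarrow> norm h - d < h x \<longrightarrow>
    (\<exists>z\<in>J. norm z \<le> 1 \<and> h z = norm h \<and> norm (x - z) \<le> 1)"
proof (rule ccontr)
  assume contra: "\<not> ?thesis"
  have "\<forall>n. \<exists>x\<in>J. norm x \<le> 1 \<and> norm h - 1 / real (Suc n) < h x \<and>
    \<not> (\<exists>z\<in>J. norm z \<le> 1 \<and> h z = norm h \<and> norm (x - z) \<le> 1)"
  proof
    fix n
    have "1 / real (Suc n) > 0" by simp
    with contra show "\<exists>x\<in>J. norm x \<le> 1 \<and> norm h - 1 / real (Suc n) < h x \<and>
      \<not> (\<exists>z\<in>J. norm z \<le> 1 \<and> h z = norm h \<and> norm (x - z) \<le> 1)" by blast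
  qed
  then obtain x where x: "\<And>n. x n \<in> J" "\<And>n. norm (x n) \<le> 1" "\<And>n. norm h - 1 / real (Suc n) < h (x n)"
    "\<And>n z. z \<in> J \<Longrightarrow> norm z \<le> 1 \<Longrightarrow> h z = norm h \<Longrightarrow> \<not> norm (x n - z) \<le> 1" by metis
  \<comment> \<open>For \<open>h = 0\<close> the point \<open>z = 0\<close> would be norming and
    within 1 of \<open>x 0\<close>.\<close>
  have "h \<noteq> 0"
    using x(4)[of "x 0" 0] x(1,2)[of 0] by auto
  then have hpos: "norm h > 0" by simp
  have "bounded (range x)" using x(2) by (auto simp: bounded_iff)
  then obtain r y w where r: "strict_mono r" and y: "range y \<subseteq> Y" and w: "(\<lambda>n. x (r n) - y n) \<longlonglongrightarrow> w"
    using finite_codim_seq_compact[OF Y] by blast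
  have yY: "y n \<in> Y" for n using y by auto
  have hY: "h v = 0" if "v \<in> Y" for v using h that by (simp add: annihilator_def)
  have "x (r n) - y n \<in> J" for n using x(1) yY J by (intro subspace_diff) auto
  then have wJ: "w \<in> J" using closed_sequentially[OF J(2) _ w] by blast
  have "(\<lambda>n. h (x (r n) - y n)) \<longlonglongrightarrow> h w" by (intro blinfun.tendsto tendsto_const w)
  then have hw1: "(\<lambda>n. h (x (r n))) \<longlonglongrightarrow> h w" using hY yY by (simp add: blinfun.diff_right)
  have "(\<lambda>n. h (x (r n))) \<longlonglongrightarrow> norm h"
  proof (rule tendsto_sandwich[OF always_eventually always_eventually])
    have "(\<lambda>n. norm h - 1 / real (Suc n)) \<longlonglongrightarrow> norm h - 0"
      using LIMSEQ_inverse_real_of_nat by (intro tendsto_diff tendsto_const) (simp add: inverse_eq_divide)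
    then have "((\<lambda>n. norm h - 1 / real (Suc n)) \<circ> r) \<longlonglongrightarrow> norm h"
      using LIMSEQ_subseq_LIMSEQ[OF _ r] by simp
    then show "(\<lambda>n. norm h - 1 / real (Suc (r n))) \<longlonglongrightarrow> norm h" by (simp add: o_def)
    show "(\<lambda>n. norm h) \<longlonglongrightarrow> norm h" by simp
    show "\<forall>n. norm h - 1 / real (Suc (r n)) \<le> h (x (r n))" using x(3) less_imp_le by blast
    show "\<forall>n. h (x (r n)) \<le> norm h"
    proof
      fix n
      have "h (x (r n)) \<le> norm (h (x (r n)))" by simp
      also have "\<dots> \<le> norm h * norm (x (r n))" by (rule norm_blinfun)
      also have "\<dots> \<le> norm h" using x(2) by (simp add: mult_left_le)
      finally show "h (x (r n)) \<le> norm h" .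
    qed
  qed
  then have hw: "h w = norm h" using hw1 LIMSEQ_unique by blast
  have far: "far_radius v {w} = norm (v - w)" for v by (simp add: far_radius_def)
  have ge1: "1 \<le> norm (v - w)" if "v \<in> Y" for v
  proof -
    have "norm h = norm (h (v - w))" using hY[OF that] hw by (simp add: blinfun.diff_right)
    also have "\<dots> \<le> norm h * norm (v - w)" by (rule norm_blinfun)
    finally show ?thesis using hpos by simp
  qed
  have lim0: "(\<lambda>n. norm (x (r n) - y n - w)) \<longlonglongrightarrow> 0"
    using tendsto_norm[OF tendsto_diff[OF w tendsto_const[of w]]] by simp
  have near: "norm (- y n - w) \<le> 1 + norm (x (r n) - y n - w)" for n
    using norm_triangle_ineq[of "- x (r n)" "x (r n) - y n - w"] x(2)[of "r n"] by simp
  have small: "\<exists>n. norm (x (r n) - y n - w) < e" if "e > 0" for e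
    using lim0 that by (auto simp: LIMSEQ_iff)
  have rad: "rad Y {w} = 1"
  proof (rule antisym)
    show "1 \<le> rad Y {w}" unfolding rad_def far
      using subspace_0[OF Y(1)] ge1 by (intro cINF_greatest) auto
    show "rad Y {w} \<le> 1"
    proof (rule field_le_epsilon)
      fix e :: real assume "e > 0"
      then obtain n where n: "norm (x (r n) - y n - w) < e" using small by blast
      have "rad Y {w} \<le> norm (- y n - w)"
        using rad_le_far_radius[of "{w}" "- y n" Y] subspace_neg[OF Y(1) yY] by (simp add: far)
      also have "\<dots> \<le> 1 + e" using near[of n] n by simp
      finally show "rad Y {w} \<le> 1 + e" .
    qed
  qed
  have "property_P1 J Y {{x} | x. x \<in> J}" using sp by (simp add: strongly_proximinal_def)
  moreover have "{w} \<in> {{x} | x. x \<in> J}" using wJ by blast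
  moreover have "(1/2 :: real) > 0" by simp
  ultimately obtain \<delta> where \<delta>: "\<delta> > 0"
    "approx_cent Y {w} \<delta> \<subseteq> {c + (1/2) *\<^sub>R b | c b. c \<in> cent Y {w} \<and> b \<in> cball 0 1 \<inter> J}"
    unfolding property_P1_def by blast
  \<comment> \<open>The bound \<open>\<delta>\<close> puts \<open>- y n\<close> into the approximate
    centre. The bound \<open>1 / 2\<close> and the \<open>1 / 2\<close> from strong proximinality
    add up to the distance 1 to be contradicted.\<close>
  obtain n where n: "norm (x (r n) - y n - w) < min \<delta> (1 / 2)" using small[of "min \<delta> (1 / 2)"] \<delta>(1) by auto
  have "- y n \<in> approx_cent Y {w} \<delta>"
    using near[of n] n subspace_neg[OF Y(1) yY] by (simp add: approx_cent_def far rad)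
  then obtain c b where cb: "- y n = c + (1/2) *\<^sub>R b" "c \<in> cent Y {w}" "norm b \<le> 1" using \<delta>(2) by auto
  have c: "c \<in> Y" "norm (c - w) = 1" using cb(2) by (auto simp: cent_def far rad)
  have "norm (x (r n) - (w - c)) \<le> 1"
  proof -
    have "x (r n) - (w - c) = (x (r n) - y n - w) - (1/2) *\<^sub>R b"
    proof -
      have "y n = - (c + (1/2) *\<^sub>R b)" using cb(1) by (metis minus_minus)
      then show ?thesis by simp
    qed
    also have "norm \<dots> \<le> norm (x (r n) - y n - w) + norm ((1/2) *\<^sub>R b)" by (rule norm_triangle_ineq4)
    finally show ?thesis using n cb(3) by simp
  qed
  moreover have "w - c \<in> J" using wJ c(1) J by (intro subspace_diff) auto
  moreover have "norm (w - c) \<le> 1" using c(2) by (simp add: norm_minus_commute)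
  moreover have "h (w - c) = norm h" using hw hY[OF c(1)] by (simp add: blinfun.diff_right)
  ultimately show False using x(4) by blast
qed

text \<open>Let \<open>k\<close> be the piece of \<open>h\<close> from
  \<open>small_splitting\<close>. If it were non-zero, the flipped functional
  \<open>g = h - 2 *\<^sub>R k\<close> would still be disjoint from the annihilator of
  \<open>J\<close>, hence be almost normed by some \<open>x\<close> in the unit ball of
  \<open>J\<close>. As \<open>k\<close> is small, \<open>x\<close> almost norms \<open>h\<close>, so
  some norming point \<open>z\<close> lies within 1 of it. But \<open>k z = norm k\<close> while
  \<open>k x\<close> is close to \<open>- norm k\<close>.\<close>

lemma perturbation_contains_half:
  fixes Y J :: "'a::real_normed_vector set" and h :: "'a \<Rightarrow>\<^sub>L real" and M :: "'m measure"
    and \<rho> :: "('a \<Rightarrow>\<^sub>L real) \<Rightarrow> 'm \<Rightarrow> real"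
  assumes rep: "L1_representation M \<rho>"
    and Y: "subspace Y" "closed Y" "finite_codim Y" and J: "subspace J" "closed J" "Y \<subseteq> J"
    and sp: "strongly_proximinal J Y" and h: "h \<in> annihilator Y"
    and disjoint: "\<And>j. j \<in> annihilator J \<Longrightarrow> norm (h + j) = norm h + norm j"
  shows "\<exists>d>0. \<forall>s. norm (s - h) < d \<longrightarrow> norm s = norm ((1 / 2) *\<^sub>R h) + norm (s - (1 / 2) *\<^sub>R h)"
proof -
  interpret L1_representation M \<rho> by (rule rep)
  obtain d where d: "d > 0" "\<And>x. x \<in> J \<Longrightarrow> norm x \<le> 1 \<Longrightarrow> norm h - d < h x \<Longrightarrow>
    \<exists>z\<in>J. norm z \<le> 1 \<and> h z = norm h \<and> norm (x - z) \<le> 1"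
    using strongly_proximinal_norming[OF Y J sp h] by blast
  have "norm s = norm ((1 / 2) *\<^sub>R h) + norm (s - (1 / 2) *\<^sub>R h)" if s: "norm (s - h) < d / 8" for s
  proof -
    obtain k where k: "norm k \<le> 2 * norm (s - h)" "norm h = norm (h - k) + norm k"
      "\<And>j. norm (h + j) = norm h + norm j \<Longrightarrow> norm (h - j) = norm h + norm j \<Longrightarrow>
        norm (h - 2 *\<^sub>R k - j) = norm h + norm j"
      "k = 0 \<Longrightarrow> norm s = norm ((1 / 2) *\<^sub>R h) + norm (s - (1 / 2) *\<^sub>R h)"
      using small_splitting[of s h] by blast
    define g where "g = h - 2 *\<^sub>R k"
    have ng: "norm g = norm h" using k(3)[of 0] by (simp add: g_def)
    have "k = 0"
    proof (rule ccontr)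
      assume "k \<noteq> 0"
      \<comment> \<open>With \<open>norm k < d / 4\<close>, the loss
        \<open>\<eta> + 2 * norm k\<close> stays below \<open>d\<close>. The bound by
        \<open>norm k\<close> gives \<open>k z - k x > norm k\<close> at the end.\<close>
      define \<eta> where "\<eta> = min (norm k) (d / 4)"
      have \<eta>: "\<eta> > 0" using \<open>k \<noteq> 0\<close> d(1) by (simp add: \<eta>_def)
      have "norm g \<le> norm (g - j)" if j: "j \<in> annihilator J" for j
        using k(3)[OF disjoint[OF j]] disjoint[of "- j"] subspace_neg[OF subspace_annihilator j]
        by (simp add: ng flip: g_def)
      then obtain x where x: "x \<in> J" "norm x \<le> 1" "g x > norm g - \<eta>"
        using hahn_banach_restriction_norm[OF J(1) _ \<eta>] by blast
      have bound: "\<phi> u \<le> norm \<phi>" if "norm u \<le> 1" for \<phi> :: "'a \<Rightarrow>\<^sub>L real" and u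
      proof -
        have "\<phi> u \<le> norm (\<phi> u)" by simp
        also have "\<dots> \<le> norm \<phi> * norm u" by (rule norm_blinfun)
        also have "\<dots> \<le> norm \<phi>" using that by (simp add: mult_left_le)
        finally show ?thesis .
      qed
      have gx: "g x = h x - 2 * k x" by (simp add: g_def blinfun.diff_left blinfun.scaleR_left)
      have "- norm k \<le> k x" using bound[of "- x" k] x(2) by (simp add: blinfun.minus_right)
      then have "norm h - d < h x" using x(3) gx ng k(1) s d(1) by (auto simp: \<eta>_def)
      then obtain z where z: "z \<in> J" "norm z \<le> 1" "h z = norm h" "norm (x - z) \<le> 1"
        using d(2)[OF x(1,2)] by blast
      have "h z - k z \<le> norm (h - k)" "h x - k x \<le> norm (h - k)"
        using bound[OF z(2), of "h - k"] bound[OF x(2), of "h - k"] by (simp_all add: blinfun.diff_left)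
      moreover have "k z - k x \<le> norm k"
        using bound[of "z - x" k] z(4) by (simp add: blinfun.diff_right norm_minus_commute)
      ultimately show False using x(3) gx ng k(2) z(3) by (simp add: \<eta>_def)
    qed
    then show ?thesis by (rule k(4))
  qed
  moreover have "d / 8 > 0" using d(1) by simp
  ultimately show ?thesis by blast
qed

text \<open>The parts of \<open>s\<close> in \<open>N\<close> form a compact set, so one has maximal
  norm. A non-zero part \<open>k\<close> of the remainder would make \<open>h + k\<close> a part of
  larger norm.\<close>

lemma maximal_norm_part:
  fixes N :: "'b::real_normed_vector set"
  assumes N: "subspace N" "closed N" "N \<subseteq> span B" "finite B"
  obtains h where "h \<in> N" "norm s = norm h + norm (s - h)"
    "\<And>k. k \<in> N \<Longrightarrow> norm (s - h) = norm k + norm (s - h - k) \<Longrightarrow> k = 0"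
proof -
  define D where "D = N \<inter> {h. norm s = norm h + norm (s - h)}"
  have "closed D" unfolding D_def by (intro closed_Int N closed_Collect_eq continuous_intros)
  moreover have "D \<subseteq> span B" using N(3) by (auto simp: D_def)
  moreover have "norm h \<le> norm s" if "h \<in> D" for h using that by (simp add: D_def)
  then have "bounded D" by (auto simp: bounded_iff)
  ultimately have "compact D"
    unfolding compact_def using finite_span_seq_compact[OF _ N(4), of D] bounded_subset
    by (metis image_subsetI)
  moreover have "0 \<in> D" using subspace_0[OF N(1)] by (simp add: D_def)
  ultimately obtain h where h: "h \<in> D" "\<And>k. k \<in> D \<Longrightarrow> norm k \<le> norm h"
    using continuous_attains_sup[of D norm] continuous_on_norm_id by blast
  show thesis
  proof (rule that[of h])
    fix k assume k: "k \<in> N" "norm (s - h) = norm k + norm (s - h - k)"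
    have "norm s = norm h + norm k + norm (s - (h + k))" using h(1) k(2) by (simp add: D_def algebra_simps)
    moreover have "norm s \<le> norm (h + k) + norm (s - (h + k))"
      using norm_triangle_ineq[of "h + k" "s - (h + k)"] by simp
    moreover have "norm (h + k) \<le> norm h + norm k" by (rule norm_triangle_ineq)
    ultimately have "norm (h + k) = norm h + norm k" "norm s = norm (h + k) + norm (s - (h + k))" by linarith+
    moreover from this have "h + k \<in> D" using h(1) k(1) subspace_add[OF N(1)] by (simp add: D_def)
    ultimately show "k = 0" using h(2)[of "h + k"] by simp
  qed (use h in \<open>auto simp: D_def\<close>)
qed

text \<open>If no \<open>C\<close> worked, normalised counterexamples would converge, along a
  subsequence, to some \<open>h\<close> in \<open>N\<close> of norm 1. By \<open>half\<close>, the
  non-zero functional \<open>h / 2\<close> would then be a part of one of them, and rescaling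
  contradicts the absence of parts.\<close>

lemma norm_le_distance_if_no_part:
  fixes N :: "'b::real_normed_vector set"
  assumes N: "subspace N" "closed N" "N \<subseteq> span B" "finite B"
    and half: "\<And>h. h \<in> N \<Longrightarrow> \<exists>d>0. \<forall>s. norm (s - h) < d \<longrightarrow>
      norm s = norm ((1 / 2) *\<^sub>R h) + norm (s - (1 / 2) *\<^sub>R h)"
  shows "\<exists>C>0. \<forall>s. (\<forall>k\<in>N. norm s = norm k + norm (s - k) \<longrightarrow> k = 0) \<longrightarrow>
    (\<forall>g\<in>N. norm s \<le> C * norm (s - g))"
proof (rule ccontr)
  assume contra: "\<not> ?thesis"
  have "\<forall>n. \<exists>s g. (\<forall>k\<in>N. norm s = norm k + norm (s - k) \<longrightarrow> k = 0) \<and> g \<in> N \<and>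
    real (Suc n) * norm (s - g) < norm s"
  proof
    fix n
    have "real (Suc n) > 0" by simp
    with contra show "\<exists>s g. (\<forall>k\<in>N. norm s = norm k + norm (s - k) \<longrightarrow> k = 0) \<and> g \<in> N \<and>
      real (Suc n) * norm (s - g) < norm s" by (meson not_less)
  qed
  then obtain s g where s: "\<And>n k. k \<in> N \<Longrightarrow> norm (s n) = norm k + norm (s n - k) \<Longrightarrow> k = 0"
    and g: "\<And>n. g n \<in> N" and lt: "\<And>n. real (Suc n) * norm (s n - g n) < norm (s n)" by metis
  have spos: "norm (s n) > 0" for n
    using le_less_trans[OF _ lt[of n], of 0] by simp
  define u where "u n = (1 / norm (s n)) *\<^sub>R s n" for n
  define v where "v n = (1 / norm (s n)) *\<^sub>R g n" for n
  have u1: "norm (u n) = 1" for n using spos[of n] by (simp add: u_def)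
  have vN: "v n \<in> N" for n unfolding v_def by (intro subspace_scale N g)
  have uv: "norm (u n - v n) \<le> 1 / real (Suc n)" for n
  proof -
    have "norm (u n - v n) = norm (s n - g n) / norm (s n)"
      by (simp add: u_def v_def flip: scaleR_right_diff_distrib)
    also have "\<dots> \<le> 1 / real (Suc n)" using lt[of n] spos[of n] by (simp add: field_simps)
    finally show ?thesis .
  qed
  have "norm (v n) \<le> 2" for n
  proof -
    have "norm (v n) \<le> norm (u n) + norm (u n - v n)"
      using norm_triangle_ineq4[of "u n" "u n - v n"] by simp
    also have "\<dots> \<le> 1 + 1" using u1[of n] uv[of n] by (intro add_mono) (auto intro: order_trans)
    finally show ?thesis by simp
  qed
  then have "bounded (range v)" by (auto simp: bounded_iff)
  moreover have "range v \<subseteq> N" using vN by auto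
  ultimately obtain r h where r: "strict_mono r" "(v \<circ> r) \<longlonglongrightarrow> h" "h \<in> N"
    using finite_span_seq_compact[OF N(3,4,2)] by blast
  have "(\<lambda>n. u n - v n) \<longlonglongrightarrow> 0"
    by (rule Lim_null_comparison[OF always_eventually LIMSEQ_inverse_real_of_nat])
      (use uv in \<open>simp add: inverse_eq_divide\<close>)
  then have "((\<lambda>n. u n - v n) \<circ> r) \<longlonglongrightarrow> 0" by (rule LIMSEQ_subseq_LIMSEQ[OF _ r(1)])
  from tendsto_add[OF this r(2)] have u: "(\<lambda>n. u (r n)) \<longlonglongrightarrow> h" by (simp add: o_def)
  have "norm h = 1" using LIMSEQ_unique[OF tendsto_norm[OF u]] u1 by simp
  obtain d where d: "d > 0" "\<And>s. norm (s - h) < d \<Longrightarrow> norm s = norm ((1 / 2) *\<^sub>R h) + norm (s - (1 / 2) *\<^sub>R h)"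
    using half[OF r(3)] by blast
  obtain n where "norm (u (r n) - h) < d" using u d(1) by (auto simp: LIMSEQ_iff)
  then have part: "norm (u (r n)) = norm ((1 / 2) *\<^sub>R h) + norm (u (r n) - (1 / 2) *\<^sub>R h)" by (rule d(2))
  define c where "c = norm (s (r n))"
  have c: "c > 0" "s (r n) = c *\<^sub>R u (r n)" using spos[of "r n"] by (simp_all add: u_def c_def)
  have "norm (s (r n)) = c * norm ((1 / 2) *\<^sub>R h) + c * norm (u (r n) - (1 / 2) *\<^sub>R h)"
    using c part by (simp add: distrib_left)
  also have "\<dots> = norm (c *\<^sub>R (1 / 2) *\<^sub>R h) + norm (c *\<^sub>R (u (r n) - (1 / 2) *\<^sub>R h))"
    using c(1) by simp
  also have "\<dots> = norm (c *\<^sub>R (1 / 2) *\<^sub>R h) + norm (s (r n) - c *\<^sub>R (1 / 2) *\<^sub>R h)"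
    by (simp add: c(2) scaleR_right_diff_distrib)
  finally have "c *\<^sub>R (1 / 2) *\<^sub>R h = 0"
    by (intro s[of _ "r n"] subspace_scale N r(3))
  then show False using c(1) \<open>norm h = 1\<close> by auto
qed

text \<open>\<open>P s\<close> is split off first, so that the compactness argument is only needed on the kernel of \<open>P\<close>.\<close>

lemma norm_part_near:
  fixes N :: "'b::real_normed_vector set" and P :: "'b \<Rightarrow> 'b"
  assumes N: "subspace N" "closed N" "N \<subseteq> span B" "finite B"
    and P: "linear P" "P \<circ> P = P" "range P \<subseteq> N" "\<And>\<phi>. norm \<phi> = norm (P \<phi>) + norm (\<phi> - P \<phi>)"
    and half: "\<And>h. h \<in> N \<Longrightarrow> P h = 0 \<Longrightarrow> \<exists>d>0. \<forall>s. norm (s - h) < d \<longrightarrow>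
      norm s = norm ((1 / 2) *\<^sub>R h) + norm (s - (1 / 2) *\<^sub>R h)"
  shows "\<exists>C>0. \<forall>s. \<exists>h\<in>N. norm s = norm h + norm (s - h) \<and> (\<forall>g\<in>N. norm (s - h) \<le> C * norm (s - g))"
proof -
  define K where "K = N \<inter> {h. P h = 0}"
  have PP: "P (P x) = P x" for x using fun_cong[OF P(2), of x] by simp
  have bl: "bounded_linear P"
  proof (intro bounded_linear.intro P(1) bounded_linear_axioms.intro exI[of _ 1] allI)
    fix x show "norm (P x) \<le> norm x * 1" using P(4)[of x] by simp
  qed
  have K: "subspace K" "closed K" "K \<subseteq> span B"
  proof -
    show "subspace K" unfolding K_def using P(1)
      by (intro subspace_inter N) (auto simp: subspace_def linear_0 linear_add linear_scale)
    show "closed K" unfolding K_def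
      by (intro closed_Int N closed_Collect_eq continuous_intros linear_continuous_on bl)
    show "K \<subseteq> span B" using N(3) by (auto simp: K_def)
  qed
  obtain C where C: "C > 0" "\<And>s g. (\<And>k. k \<in> K \<Longrightarrow> norm s = norm k + norm (s - k) \<Longrightarrow> k = 0) \<Longrightarrow>
    g \<in> K \<Longrightarrow> norm s \<le> C * norm (s - g)"
    using norm_le_distance_if_no_part[OF K N(4)] half unfolding K_def by blast
  show ?thesis
  proof (intro exI[of _ C] conjI allI C(1))
    fix s
    define s0 where "s0 = s - P s"
    obtain h where h: "h \<in> K" "norm s0 = norm h + norm (s0 - h)"
      "\<And>k. k \<in> K \<Longrightarrow> norm (s0 - h) = norm k + norm (s0 - h - k) \<Longrightarrow> k = 0"
      using maximal_norm_part[OF K N(4), of s0] by blast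
    \<comment> \<open>The sought part is \<open>P s + h\<close>. Since \<open>P\<close> maps it to
      \<open>P s\<close>, the two norms add.\<close>
    have Ph: "P (P s + h) = P s" using h(1) P(1) PP by (simp add: linear_add K_def)
    show "\<exists>h\<in>N. norm s = norm h + norm (s - h) \<and> (\<forall>g\<in>N. norm (s - h) \<le> C * norm (s - g))"
    proof (intro bexI[of _ "P s + h"] conjI ballI)
      show "P s + h \<in> N" using h(1) P(3) by (intro subspace_add N) (auto simp: K_def)
      have "norm (P s + h) = norm (P s) + norm h" using P(4)[of "P s + h"] Ph by simp
      then show "norm s = norm (P s + h) + norm (s - (P s + h))"
        using P(4)[of s] h(2) by (simp add: s0_def algebra_simps)
      fix g assume g: "g \<in> N"
      \<comment> \<open>Passing from \<open>g\<close> to \<open>g0\<close> lands in the kernel of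
        \<open>P\<close> without increasing distances, because \<open>s - P s\<close> depends on
        \<open>s\<close> with Lipschitz constant 1.\<close>
      define g0 where "g0 = g - P g"
      have "P (g0 - h) = 0" using h(1) P(1) PP by (simp add: linear_diff K_def g0_def)
      moreover have "g0 - h \<in> N" unfolding g0_def using g h(1) P(3) by (intro subspace_diff N) (auto simp: K_def)
      ultimately have "norm (s0 - h) \<le> C * norm (s0 - h - (g0 - h))"
        by (intro C(2) h(3)) (auto simp: K_def)
      also have "norm (s0 - h - (g0 - h)) = norm ((s - g) - P (s - g))"
        by (simp add: s0_def g0_def linear_diff[OF P(1)] algebra_simps)
      also have "\<dots> \<le> norm (s - g)" using P(4)[of "s - g"] by simp
      finally show "norm (s - (P s + h)) \<le> C * norm (s - g)" using C(1) by (simp add: s0_def algebra_simps)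
    qed
  qed
qed

section \<open>Improving approximate centres\<close>

text \<open>As the sum of the functionals vanishes on \<open>Y\<close>, the point \<open>v\<close>
  may be replaced by any other point of \<open>Y\<close>, in particular by an almost optimal
  centre.\<close>

lemma annihilating_sum_bound:
  fixes Y :: "'a::real_normed_vector set" and e :: "'a \<Rightarrow> 'a \<Rightarrow>\<^sub>L real"
  assumes Y: "subspace Y" and F: "bounded F" "F \<noteq> {}" and K: "K \<subseteq> F"
    and e: "(\<Sum>i\<in>K. e i) \<in> annihilator Y" and v: "v \<in> Y"
  shows "(\<Sum>i\<in>K. e i (i - v)) \<le> rad Y F * (\<Sum>i\<in>K. norm (e i))"
proof (rule field_le_epsilon)
  fix \<epsilon> :: real assume \<epsilon>: "\<epsilon> > 0"
  define B where "B = (\<Sum>i\<in>K. norm (e i))"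
  have B: "B \<ge> 0" by (simp add: B_def sum_nonneg)
  define \<eta> where "\<eta> = \<epsilon> / (1 + B)"
  have \<eta>: "\<eta> > 0" using \<epsilon> B by (simp add: \<eta>_def)
  have "Y \<noteq> {}" using v by blast
  then obtain y where y: "y \<in> approx_cent Y F \<eta>" using approx_cent_nonempty[OF _ \<eta>] by blast
  then have yY: "y \<in> Y" by (simp add: approx_cent_def)
  have "(\<Sum>i\<in>K. e i) (y - v) = 0" using e subspace_diff[OF Y yY v] by (simp add: annihilator_def)
  then have "(\<Sum>i\<in>K. e i (y - v)) = 0" by (simp add: blinfun.sum_left)
  moreover have "(\<Sum>i\<in>K. e i (i - v)) = (\<Sum>i\<in>K. e i (i - y)) + (\<Sum>i\<in>K. e i (y - v))"
    by (simp add: blinfun.diff_right flip: sum.distrib)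
  moreover have "(\<Sum>i\<in>K. e i (i - y)) \<le> (\<Sum>i\<in>K. norm (e i) * (rad Y F + \<eta>))"
  proof (rule sum_mono)
    fix i assume "i \<in> K"
    then have "norm (i - y) \<le> rad Y F + \<eta>"
      using y K by (auto simp: approx_cent_iff[OF F] norm_minus_commute)
    then have "norm (e i) * norm (i - y) \<le> norm (e i) * (rad Y F + \<eta>)" by (intro mult_left_mono) auto
    then show "e i (i - y) \<le> norm (e i) * (rad Y F + \<eta>)"
      using norm_blinfun[of "e i" "i - y"] by simp
  qed
  moreover have "(\<Sum>i\<in>K. norm (e i) * (rad Y F + \<eta>)) = rad Y F * B + B * \<eta>"
    unfolding B_def sum_distrib_right[symmetric] by (simp add: algebra_simps)
  moreover have "B * \<eta> \<le> \<epsilon>" using B \<epsilon> by (simp add: \<eta>_def field_simps)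
  ultimately show "(\<Sum>i\<in>K. e i (i - v)) \<le> rad Y F * (\<Sum>i\<in>K. norm (e i)) + \<epsilon>" by (simp add: B_def)
qed

text \<open>The correction \<open>y\<close> added to \<open>v\<close> is a common point in
  \<open>Y\<close> of a ball around 0, which keeps it short, and of balls around the
  \<open>k - v\<close> for a finite net \<open>K\<close> of \<open>F\<close>. The dual inequality
  for these balls follows by splitting the functionals according to the part \<open>h\<close> of
  their sum.\<close>

lemma approx_cent_improvement:
  fixes Y :: "'a::real_normed_vector set" and M :: "'m measure"
    and \<rho> :: "('a \<Rightarrow>\<^sub>L real) \<Rightarrow> 'm \<Rightarrow> real"
  assumes rep: "L1_representation M \<rho>" and Y: "subspace Y"
    and C: "C > 0" "\<And>s. \<exists>h\<in>annihilator Y. norm s = norm h + norm (s - h) \<and>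
      (\<forall>g\<in>annihilator Y. norm (s - h) \<le> C * norm (s - g))"
    and F: "compact F" "F \<noteq> {}" and \<epsilon>: "\<epsilon> > 0" and \<eta>: "\<eta> > 0"
    and v: "v \<in> approx_cent Y F (\<epsilon> / (2 * C))"
  shows "\<exists>w\<in>approx_cent Y F \<eta>. norm (v - w) \<le> \<epsilon>"
proof -
  interpret L1_representation M \<rho> by (rule rep)
  have bF: "bounded F" by (rule compact_imp_bounded[OF F(1)])
  have vY: "v \<in> Y" using v by (simp add: approx_cent_def)
  define R where "R = rad Y F"
  define \<delta> where "\<delta> = \<epsilon> / (2 * C)"
  have \<delta>: "\<delta> > 0" using \<epsilon> C(1) by (simp add: \<delta>_def)
  have R: "R \<ge> 0" unfolding R_def using vY by (intro rad_nonneg bF F) auto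
  have vd: "norm (z - v) \<le> R + \<delta>" if "z \<in> F" for z
    using v that by (auto simp: approx_cent_iff[OF bF F(2)] R_def \<delta>_def norm_minus_commute)
  obtain K where K: "finite K" "K \<subseteq> F" "F \<subseteq> (\<Union>x\<in>K. ball x (\<eta> / 2))"
    using compactE_image[OF F(1), of F "\<lambda>x. ball x (\<eta> / 2)"] \<eta> by (force intro: that)
  \<comment> \<open>\<open>None\<close> indexes the ball around 0, \<open>Some k\<close> the ball
    around \<open>k - v\<close>.\<close>
  define I where "I = insert None (Some ` K)"
  define x where "x i = (case i of None \<Rightarrow> 0 | Some k \<Rightarrow> k - v)" for i
  define r where "r i = (case i of None \<Rightarrow> \<epsilon> / 2 | Some k \<Rightarrow> R + \<eta> / 4)" for i :: "'a option"
  have sum_I: "(\<Sum>i\<in>I. G i) = G None + (\<Sum>k\<in>K. G (Some k))" for G :: "'a option \<Rightarrow> 'c::comm_monoid_add"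
    using K(1) by (simp add: I_def sum.reindex)
  \<comment> \<open>Chosen so that \<open>t * (\<epsilon> / 2) \<le> \<epsilon>\<close> and
    \<open>t * (R + \<eta> / 4) \<le> R + \<eta> / 2\<close>; the other \<open>\<eta> / 2\<close> is
    used up by the net. The summand \<open>\<eta> / 4\<close> keeps the radius positive even if
    \<open>R = 0\<close>.\<close>
  define t where "t = 1 + min 1 (\<eta> / (4 * (R + \<eta> / 4)))"
  have "\<exists>y\<in>Y. \<forall>i\<in>I. norm (x i - y) \<le> t * r i"
  proof (rule finite_balls_meet_subspace)
    show "finite I" using K(1) by (simp add: I_def)
    show "r i > 0" for i using \<epsilon> R \<eta> by (auto simp: r_def split: option.split)
    show "t > 1" using R \<eta> by (simp add: t_def)
    show "subspace Y" by (rule Y)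
    fix f :: "'a option \<Rightarrow> 'a \<Rightarrow>\<^sub>L real"
    assume f: "(\<Sum>i\<in>I. f i) \<in> annihilator Y"
    define g where "g k = f (Some k)" for k
    define s where "s = (\<Sum>k\<in>K. g k)"
    have fs: "f None + s \<in> annihilator Y" using f by (simp add: sum_I s_def g_def)
    obtain h where h: "h \<in> annihilator Y" "norm s = norm h + norm (s - h)"
      "\<forall>g\<in>annihilator Y. norm (s - h) \<le> C * norm (s - g)" using C(2) by blast
    \<comment> \<open>The functional at \<open>None\<close> measures how far \<open>s\<close> is
      from annihilating \<open>Y\<close>.\<close>
    from h(3) fs have "norm (s - h) \<le> C * norm (s - (f None + s))" by blast
    then have sh: "norm (s - h) \<le> C * norm (f None)" by simp
    obtain k where k: "(\<Sum>i\<in>K. k i) = s - h" "\<And>i. i \<in> K \<Longrightarrow> norm (g i) = norm (k i) + norm (g i - k i)"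
      "(\<Sum>i\<in>K. norm (k i)) = norm (s - h)"
      using riesz_decomposition[OF K(1), of g h] h(2) unfolding s_def by blast
    \<comment> \<open>The pieces \<open>g i - k i\<close> sum to an annihilating functional and obey
      the bound with \<open>R\<close>; only the pieces \<open>k i\<close> pay
      \<open>R + \<delta>\<close>, and their total norm is \<open>norm (s - h)\<close>.\<close>
    have "(\<Sum>i\<in>K. (g i - k i)) = h" by (simp add: sum_subtractf k(1) flip: s_def)
    then have "(\<Sum>i\<in>K. (g i - k i) (i - v)) \<le> R * (\<Sum>i\<in>K. norm (g i - k i))"
      unfolding R_def using h(1) by (intro annihilating_sum_bound[OF Y bF F(2) K(2) _ vY]) simp
    moreover have "(\<Sum>i\<in>K. k i (i - v)) \<le> (\<Sum>i\<in>K. norm (k i) * (R + \<delta>))"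
    proof (rule sum_mono)
      fix i assume "i \<in> K"
      then have "norm (k i) * norm (i - v) \<le> norm (k i) * (R + \<delta>)"
        using vd K(2) by (intro mult_left_mono) auto
      then show "k i (i - v) \<le> norm (k i) * (R + \<delta>)" using norm_blinfun[of "k i" "i - v"] by simp
    qed
    moreover have "(\<Sum>i\<in>K. norm (k i) * (R + \<delta>)) = R * (\<Sum>i\<in>K. norm (k i)) + \<delta> * norm (s - h)"
      unfolding k(3)[symmetric] sum_distrib_right[symmetric] by (simp add: algebra_simps)
    moreover have "(\<Sum>i\<in>K. g i (i - v)) = (\<Sum>i\<in>K. (g i - k i) (i - v)) + (\<Sum>i\<in>K. k i (i - v))"
      by (simp add: blinfun.diff_left flip: sum.distrib)
    moreover have "R * (\<Sum>i\<in>K. norm (g i)) = R * (\<Sum>i\<in>K. norm (g i - k i)) + R * (\<Sum>i\<in>K. norm (k i))"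
      using k(2) by (simp add: sum.distrib flip: distrib_left)
    \<comment> \<open>Here \<open>\<delta> * C = \<epsilon> / 2\<close> turns the extra cost into
      the contribution of the ball around 0.\<close>
    moreover have "\<delta> * norm (s - h) \<le> \<epsilon> / 2 * norm (f None)"
      using mult_left_mono[OF sh, of \<delta>] \<delta> C(1) by (simp add: \<delta>_def)
    moreover have "R * (\<Sum>i\<in>K. norm (g i)) \<le> (R + \<eta> / 4) * (\<Sum>i\<in>K. norm (g i))"
      using \<eta> by (intro mult_right_mono sum_nonneg) auto
    ultimately have "(\<Sum>i\<in>K. g i (i - v)) \<le> \<epsilon> / 2 * norm (f None) + (R + \<eta> / 4) * (\<Sum>i\<in>K. norm (g i))"
      by linarith
    then show "(\<Sum>i\<in>I. f i (x i)) \<le> (\<Sum>i\<in>I. r i * norm (f i))"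
      by (simp add: sum_I x_def r_def g_def sum_distrib_left)
  qed
  then obtain y where y: "y \<in> Y" "\<And>i. i \<in> I \<Longrightarrow> norm (x i - y) \<le> t * r i" by blast
  have "norm y \<le> t * (\<epsilon> / 2)" using y(2)[of None] by (simp add: I_def x_def r_def)
  also have "\<dots> \<le> 2 * (\<epsilon> / 2)" using \<epsilon> by (intro mult_right_mono) (auto simp: t_def)
  finally have ny: "norm y \<le> \<epsilon>" by simp
  have "(t - 1) * (R + \<eta> / 4) \<le> \<eta> / (4 * (R + \<eta> / 4)) * (R + \<eta> / 4)"
    using R \<eta> by (intro mult_right_mono) (auto simp: t_def)
  also have "\<dots> = \<eta> / 4"
  proof -
    have *: "\<eta> / (4 * q) * q = \<eta> / 4" if "q > 0" for q :: real using that by simp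
    show ?thesis by (rule *) (use R \<eta> in simp)
  qed
  finally have tR: "t * (R + \<eta> / 4) \<le> R + \<eta> / 2" by (simp add: left_diff_distrib)
  have "norm (v + y - z) \<le> R + \<eta>" if z: "z \<in> F" for z
  proof -
    obtain k where k: "k \<in> K" "norm (k - z) < \<eta> / 2" using K(3) z by (auto simp: dist_norm)
    have "norm (k - v - y) \<le> R + \<eta> / 2" using y(2)[of "Some k"] k(1) tR by (simp add: I_def x_def r_def)
    moreover have "norm (v + y - z) \<le> norm (k - v - y) + norm (k - z)"
      using norm_triangle_ineq4[of "k - z" "k - v - y"] by (simp add: algebra_simps)
    ultimately show ?thesis using k(2) by simp
  qed
  then have "v + y \<in> approx_cent Y F \<eta>"
    using subspace_add[OF Y vY y(1)] by (simp add: approx_cent_iff[OF bF F(2)] R_def)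
  with ny show ?thesis by (intro bexI[of _ "v + y"]) auto
qed

theorem proposition5p2:
  fixes \<mu> :: "'m measure" and Y J :: "'a::banach set"
  assumes "L1_predual_of TYPE('a) \<mu>"
    and "subspace Y" and "closed Y" and "finite_codim Y"
    and "M_ideal J" and "Y \<subseteq> J"
    and "strongly_proximinal J Y"
  shows "property_P1 UNIV Y (nonempty_compacts UNIV)"
proof -
  obtain T :: "('a \<Rightarrow>\<^sub>L real) \<Rightarrow> ('m \<Rightarrow> real) set" where "isometry_onto_L1 \<mu> T"
    using assms(1) by (auto simp: L1_predual_of_def)
  then obtain \<rho> :: "('a \<Rightarrow>\<^sub>L real) \<Rightarrow> 'm \<Rightarrow> real" where rep: "L1_representation \<mu> \<rho>"
    using L1_representation_exists by blast
  obtain P :: "('a \<Rightarrow>\<^sub>L real) \<Rightarrow> 'a \<Rightarrow>\<^sub>L real" where J: "subspace J" "closed J" and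
    P: "linear P" "P \<circ> P = P" "range P = annihilator J" "\<And>\<phi>. norm \<phi> = norm (P \<phi>) + norm (\<phi> - P \<phi>)"
    using assms(5) unfolding M_ideal_def by blast
  obtain S where S: "finite S" "annihilator Y \<subseteq> span S" using annihilator_finite_span[OF assms(4)] .
  have "\<exists>C>0. \<forall>s. \<exists>h\<in>annihilator Y. norm s = norm h + norm (s - h) \<and>
      (\<forall>g\<in>annihilator Y. norm (s - h) \<le> C * norm (s - g))"
  proof (rule norm_part_near[OF subspace_annihilator closed_annihilator S(2,1) P(1,2) _ P(4)])
    show "range P \<subseteq> annihilator Y" unfolding P(3) by (rule annihilator_mono[OF assms(6)])
    fix h assume h: "h \<in> annihilator Y" "P h = 0"
    \<comment> \<open>The projection fixes \<open>j\<close> and kills \<open>h\<close>, so its norm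
      identity at \<open>h + j\<close> is the required disjointness.\<close>
    have "norm (h + j) = norm h + norm j" if "j \<in> annihilator J" for j
    proof -
      have "j \<in> range P" using that by (simp add: P(3))
      then obtain i where "j = P i" by (rule rangeE)
      then have "P j = j" using fun_cong[OF P(2), of i] by simp
      then show ?thesis using P(4)[of "h + j"] h(2) by (simp add: linear_add[OF P(1)])
    qed
    then show "\<exists>d>0. \<forall>s. norm (s - h) < d \<longrightarrow> norm s = norm ((1 / 2) *\<^sub>R h) + norm (s - (1 / 2) *\<^sub>R h)"
      by (rule perturbation_contains_half[OF rep assms(2-4) J assms(6,7) h(1)])
  qed
  then obtain C where C: "C > 0" "\<And>s. \<exists>h\<in>annihilator Y. norm s = norm h + norm (s - h) \<and>
      (\<forall>g\<in>annihilator Y. norm (s - h) \<le> C * norm (s - g))" by blast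
  show ?thesis
  proof (rule property_P1_UNIV_I[OF assms(3)])
    show "Y \<noteq> {}" using subspace_0[OF assms(2)] by blast
    fix F :: "'a set" assume "F \<in> nonempty_compacts UNIV"
    then have F: "compact F" "F \<noteq> {}" by (auto simp: nonempty_compacts_def)
    then show "bounded F \<and> F \<noteq> {}" by (simp add: compact_imp_bounded)
    fix e :: real assume e: "e > 0"
    then have "e / (2 * C) > 0" using C(1) by simp
    then show "\<exists>\<delta>>0. \<forall>\<eta>>0. \<forall>v\<in>approx_cent Y F \<delta>. \<exists>w\<in>approx_cent Y F \<eta>. norm (v - w) \<le> e"
      using approx_cent_improvement[OF rep assms(2) C F e] by blast
  qed
qed

end
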